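(* Let $V$ be a (nonempty) analytic subvariety of $\mathbb D^2$ that is polynomially convex. Then $V$ is a Carathéodory set (in $\mathbb D^2$) if and only if it is a holomorphic retract of $\mathbb D^2$.
   Context: $\mathbb D$ is the open unit disc and $\rho$ the hyperbolic (Poincaré) distance on $\mathbb D$. An analytic subvariety of a domain $D\subset\mathbb C^n$ is a relatively closed $V\subset D$ such that each $x\in V$ has an open neighborhood $U\subset D$ and finitely many $f_1,\dots,f_m$ holomorphic on $U$ with $V\cap U=\{f_1=\dots=f_m=0\}$. A function $f:V\to\mathbb C$ is holomorphic if every $w\in V$ has a neighborhood $W$ in $D$ and a holomorphic $g:W\to\mathbb C$ with $f=g$ on $V\cap W$; $\mathcal O(V,\mathbb D)$ denotes the holomorphic functions $V\to\mathbb D$. The Carathéodory pseudodistance is $c_V(z,w)=\sup\{\rho(F(z),F(w)):F\in\mathcal O(V,\mathbb D)\}$ (with $V=D$ this is $c_D$). $V$ is a Carathéodory set in $D$ if $c_D(z,w)=c_V(z,w)$ for all $z,w\in V$. $V\subset D$ is a holomorphic retract of $D$ if there is a holomorphic map $r:D\to D$ with range $V$ and $r|_V=\mathrm{id}_V$. Polynomial convexity of $V\subset\mathbb D^2$ is understood relative to $\mathbb D^2$: for every $z\in\mathbb D^2\setminus V$ there is a polynomial $p$ with $|p(z)|>\sup_V|p|$. *)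

theory Defs
  imports "HOL-Complex_Analysis.Complex_Analysis"
begin

text \<open>
  Holomorphic functions of several complex variables on an open set of \<open>\<complex>\<^sup>n\<close>: Frechet
  differentiable at every point, with complex-linear derivative.  The derivative is the
  unrestricted one (\<open>at z\<close>), so the notion is meant for open \<open>U\<close> only.
\<close>

definition holomorphic_Cn :: "(complex ^ 'n) set \<Rightarrow> (complex ^ 'n \<Rightarrow> complex) \<Rightarrow> bool" where
  "holomorphic_Cn U f \<longleftrightarrow>
     (\<forall>z\<in>U. \<exists>f'. (f has_derivative f') (at z) \<and> (\<forall>c v. f' (c *s v) = c * f' v))"

definition holomorphic_map :: "(complex ^ 'n) set \<Rightarrow> (complex ^ 'n \<Rightarrow> complex ^ 'm) \<Rightarrow> bool" where
  "holomorphic_map U r \<longleftrightarrow> (\<forall>i. holomorphic_Cn U (\<lambda>z. r z $ i))"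

definition polydisc :: "(complex ^ 'n) set" where
  "polydisc = {z. \<forall>i. norm (z $ i) < 1}"

definition analytic_subvariety :: "(complex ^ 'n) set \<Rightarrow> (complex ^ 'n) set \<Rightarrow> bool" where
  "analytic_subvariety D V \<longleftrightarrow>
     closedin (top_of_set D) V \<and>
     (\<forall>x\<in>V. \<exists>U F. open U \<and> x \<in> U \<and> U \<subseteq> D \<and>
        finite F \<and> (\<forall>f\<in>F. holomorphic_Cn U f) \<and>
        V \<inter> U = {z\<in>U. \<forall>f\<in>F. f z = 0})"

definition holomorphic_on_subset ::
    "(complex ^ 'n) set \<Rightarrow> (complex ^ 'n) set \<Rightarrow> (complex ^ 'n \<Rightarrow> complex) \<Rightarrow> bool" where
  "holomorphic_on_subset D V f \<longleftrightarrow>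
     (\<forall>w\<in>V. \<exists>W g. open W \<and> w \<in> W \<and> W \<subseteq> D \<and> holomorphic_Cn W g \<and> (\<forall>z\<in>V \<inter> W. f z = g z))"

definition disc_functions ::
    "(complex ^ 'n) set \<Rightarrow> (complex ^ 'n) set \<Rightarrow> (complex ^ 'n \<Rightarrow> complex) set" where
  "disc_functions D V = {F. holomorphic_on_subset D V F \<and> F ` V \<subseteq> ball 0 1}"

text \<open>
  The normalization (curvature \<open>-4\<close>) is immaterial for comparing Caratheodory pseudodistances.
\<close>

definition poincare_dist :: "complex \<Rightarrow> complex \<Rightarrow> real" where
  "poincare_dist a b = artanh (norm (Moebius_function 0 b a))"

text \<open>
  The supremum is taken in \<^typ>\<open>ereal\<close> because it may be infinite, for instance between
  points in different connected components of \<open>V\<close>.  The Caratheodory pseudodistance of \<open>D\<close>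
  itself is the case \<open>V = D\<close>.
\<close>

definition caratheodory_dist ::
    "(complex ^ 'n) set \<Rightarrow> (complex ^ 'n) set \<Rightarrow> complex ^ 'n \<Rightarrow> complex ^ 'n \<Rightarrow> ereal" where
  "caratheodory_dist D V z w =
     (SUP F\<in>disc_functions D V. ereal (poincare_dist (F z) (F w)))"

definition caratheodory_set :: "(complex ^ 'n) set \<Rightarrow> (complex ^ 'n) set \<Rightarrow> bool" where
  "caratheodory_set D V \<longleftrightarrow>
     (\<forall>z\<in>V. \<forall>w\<in>V. caratheodory_dist D D z w = caratheodory_dist D V z w)"

definition holomorphic_retract :: "(complex ^ 'n) set \<Rightarrow> (complex ^ 'n) set \<Rightarrow> bool" where
  "holomorphic_retract D V \<longleftrightarrow>
     (\<exists>r. holomorphic_map D r \<and> r ` D \<subseteq> D \<and> r ` D = V \<and> (\<forall>z\<in>V. r z = z))"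

definition polynomial_Cn :: "(complex ^ 'n \<Rightarrow> complex) \<Rightarrow> bool" where
  "polynomial_Cn p \<longleftrightarrow>
     (\<exists>(A :: ('n \<Rightarrow> nat) set) c. finite A \<and>
        p = (\<lambda>z. \<Sum>\<alpha>\<in>A. c \<alpha> * (\<Prod>i\<in>UNIV. (z $ i) ^ \<alpha> i)))"

definition polynomially_convex_in :: "(complex ^ 'n) set \<Rightarrow> (complex ^ 'n) set \<Rightarrow> bool" where
  "polynomially_convex_in D V \<longleftrightarrow>
     (\<forall>z\<in>D - V. \<exists>p. polynomial_Cn p \<and> ereal (norm (p z)) > (SUP w\<in>V. ereal (norm (p w))))"

end

theory Submission
  imports Defs
begin

text \<open>
  Write \<open>\<delta>\<close> for the pseudohyperbolic distance.  By Schwarz's lemma the Caratheodory condition says that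
  every holomorphic \<open>F\<close> from \<open>V\<close> to the disc satisfies \<open>\<delta> (F z) (F w) \<le> max (\<delta> z\<^sub>1 w\<^sub>1) (\<delta> z\<^sub>2 w\<^sub>2)\<close>.

  Call \<open>z \<noteq> w\<close> in \<open>V\<close> balanced if the two coordinate distances agree.  The graph of a disc automorphism
  through a balanced pair has its boundary circle in the closure of \<open>V\<close> (otherwise a square root
  on a slit disc violates the contraction property), so by polynomial convexity the graph lies in \<open>V\<close>.
  A further point of \<open>V\<close> then lies on infinitely many such graphs with distinct slopes;
  the lowest-order terms of the defining functions vanish for all these slopes, so \<open>V\<close> has interior
  and is the whole bidisc.

  Without balanced pairs, a connectedness argument shows that one coordinate always dominates, so \<open>V\<close>
  is the graph of a contraction over a subset of the disc.  A peak function shows that the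
  subset is everything, and the contraction is holomorphic since otherwise its difference quotients
  would accumulate at infinitely many tangent slopes of \<open>V\<close>.
\<close>

text \<open>The square root helps because squaring strictly shrinks the pseudohyperbolic distance,
  so a root strictly enlarges it. For a balanced pair the average of the two coordinate functions
  already attains the contraction bound, so any gain is a contradiction. The root exists once the
  average omits a slit, and a missing boundary point provides the slit.

  \<open>V\<close> may be singular, so no tangent space is at hand. Its substitute is the set of
  limit slopes at a point: the lowest homogeneous form of a nonzero germ in two variables vanishes
  for finitely many slopes only. This settles two quite different situations, infinitely many discs
  through one point and a difference quotient without limit. In the second one the slopes are
  infinitely many because a bounded continuous function on a punctured disc has either a limit or a
  continuum of cluster values.\<close>

no_notation fps_nth (infixl \<open>$\<close> 75)

section \<open>Moebius transformations of the disc\<close>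

text \<open>For \<open>norm a < 1\<close> this is the disc automorphism sending \<open>a\<close> to
  0, with inverse \<open>mob (- a)\<close>. Its modulus is the pseudohyperbolic distance, the tanh
  of the Poincare distance; comparisons are made at this level.\<close>

definition mob :: "complex \<Rightarrow> complex \<Rightarrow> complex" where
  "mob a z = (z - a) / (1 - cnj a * z)"

lemma Moebius_function_0_eq_mob: "Moebius_function 0 a z = mob a z"
  by (simp add: Moebius_function_simple mob_def)

lemma mob_denom_nonzero:
  assumes "norm a < 1" "norm z \<le> 1"
  shows "1 - cnj a * z \<noteq> 0"
proof
  assume "1 - cnj a * z = 0"
  then have "norm (cnj a * z) = 1" by (metis eq_iff_diff_eq_0 norm_one)
  moreover have "norm (cnj a * z) < 1"
    using assms mult_left_le[of "norm z" "norm a"] by (simp add: norm_mult)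
  ultimately show False by simp
qed

lemma mob_denom_nonzero':
  assumes "norm a < 1" "norm z \<le> 1"
  shows "1 - a * cnj z \<noteq> 0"
  using mob_denom_nonzero[OF assms] by (metis complex_cnj_cnj complex_cnj_diff complex_cnj_mult complex_cnj_one complex_cnj_zero)

lemma norm_mob_less_1: "norm a < 1 \<Longrightarrow> norm z < 1 \<Longrightarrow> norm (mob a z) < 1"
  using Moebius_function_norm_lt_1[of a z 0] by (simp add: Moebius_function_0_eq_mob)

lemma norm_mob_eq_1:
  assumes "norm a < 1" "norm z = 1"
  shows "norm (mob a z) = 1"
proof -
  have zz: "z * cnj z = 1" using assms(2) by (simp add: complex_norm_square[symmetric])
  have "1 - cnj a * z = z * cnj (z - a)" using zz by (simp add: algebra_simps)
  then have "norm (1 - cnj a * z) = norm (z - a)"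
    by (metis assms(2) complex_mod_cnj mult.left_neutral norm_mult)
  moreover have "1 - cnj a * z \<noteq> 0" using assms mob_denom_nonzero by simp
  ultimately show ?thesis unfolding mob_def norm_divide by (metis divide_self norm_eq_zero)
qed

lemma norm_mob_le_1: "norm a < 1 \<Longrightarrow> norm z \<le> 1 \<Longrightarrow> norm (mob a z) \<le> 1"
  using norm_mob_less_1[of a z] norm_mob_eq_1[of a z] by fastforce

lemma mob_self [simp]: "mob a a = 0"
  by (simp add: mob_def)

lemma mob_0_left [simp]: "mob 0 z = z"
  by (simp add: mob_def)

lemma mob_0_right [simp]: "mob a 0 = - a"
  by (simp add: mob_def)

lemma mob_eq_0_iff: "norm a < 1 \<Longrightarrow> norm z \<le> 1 \<Longrightarrow> mob a z = 0 \<longleftrightarrow> z = a"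
  using mob_denom_nonzero by (auto simp: mob_def)

lemma one_minus_norm_sq_nonzero: "norm a < 1 \<Longrightarrow> 1 - a * cnj a \<noteq> 0"
  using mob_denom_nonzero[of a a] by (simp add: mult.commute)

lemma mob_minus_mob:
  assumes "norm a < 1" "norm z \<le> 1"
  shows "mob (- a) (mob a z) = z"
proof -
  define d where "d = 1 - cnj a * z"
  have d: "d \<noteq> 0" using mob_denom_nonzero[OF assms] by (simp add: d_def)
  have e: "1 - a * cnj a \<noteq> 0" using assms one_minus_norm_sq_nonzero by blast
  have "mob a z + a = z * (1 - a * cnj a) / d"
    using d unfolding mob_def d_def[symmetric] by (simp add: field_simps) (simp add: d_def algebra_simps)
  moreover have "1 + cnj a * mob a z = (1 - a * cnj a) / d"
    using d unfolding mob_def d_def[symmetric] by (simp add: field_simps) (simp add: d_def algebra_simps)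
  ultimately show ?thesis using d e by (simp add: mob_def[of "- a"])
qed

lemma mob_mob_minus:
  assumes "norm a < 1" "norm z \<le> 1"
  shows "mob a (mob (- a) z) = z"
  using mob_minus_mob[of "- a" z] assms by simp

lemma norm_mob_commute: "norm (mob a b) = norm (mob b a)"
proof -
  have "norm (1 - cnj a * b) = norm (1 - cnj b * a)"
    by (metis complex_cnj_cnj complex_cnj_diff complex_cnj_mult complex_cnj_one complex_mod_cnj mult.commute)
  then show ?thesis by (simp add: mob_def norm_divide norm_minus_commute)
qed

text \<open>As functions of \<open>z\<close> both sides are disc automorphisms vanishing at
  \<open>mob b a\<close>, so they agree up to a unimodular constant. Writing it out shows that it
  does not depend on \<open>z\<close>.\<close>

lemma mob_mob_minus_eq:
  assumes "norm a < 1" "norm b < 1" "norm z \<le> 1"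
  shows "mob a (mob (- b) z) = (1 - a * cnj b) / (1 - cnj a * b) * mob (mob b a) z"
proof -
  define d where "d = 1 + cnj b * z"
  have d: "d \<noteq> 0" using mob_denom_nonzero[of "- b" z] assms by (simp add: d_def)
  define p where "p = 1 - cnj a * b"
  define q where "q = 1 - a * cnj b"
  have p: "p \<noteq> 0" and q: "q \<noteq> 0"
    using assms mob_denom_nonzero mob_denom_nonzero' unfolding p_def q_def by auto
  have m: "mob b a = (a - b) / q" by (simp add: mob_def q_def mult.commute)
  have cm: "cnj (mob b a) = (cnj a - cnj b) / p"
    unfolding m p_def q_def by (simp add: mult.commute)
  define n1 where "n1 = z * q - (a - b)"
  define n2 where "n2 = p - z * (cnj a - cnj b)"
  have bz: "mob (- b) z = (z + b) / d" by (simp add: mob_def d_def)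
  have L: "mob a (mob (- b) z) = n1 / n2"
  proof -
    have "mob (- b) z - a = n1 / d"
      unfolding bz using d by (simp add: field_simps) (simp add: n1_def d_def q_def algebra_simps)
    moreover have "1 - cnj a * mob (- b) z = n2 / d"
      unfolding bz using d by (simp add: field_simps) (simp add: n2_def d_def p_def algebra_simps)
    ultimately show ?thesis unfolding mob_def[of a] using d by simp
  qed
  have R: "mob (mob b a) z = (n1 / q) / (n2 / p)"
  proof -
    have "z - mob b a = n1 / q" unfolding m n1_def using q by (simp add: field_simps)
    moreover have "1 - cnj (mob b a) * z = n2 / p"
      unfolding cm n2_def using p by (simp add: field_simps)
    ultimately show ?thesis by (simp only: mob_def[of "mob b a"])
  qed
  show ?thesis unfolding L R p_def[symmetric] q_def[symmetric] using p q by simp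
qed

lemma norm_mob_factor:
  assumes "norm a < 1" "norm b < 1"
  shows "norm ((1 - a * cnj b) / (1 - cnj a * b)) = 1"
proof -
  have "cnj (1 - cnj a * b) = 1 - a * cnj b" by simp
  then have "norm (1 - cnj a * b) = norm (1 - a * cnj b)" by (metis complex_mod_cnj)
  moreover have "1 - cnj a * b \<noteq> 0" using assms mob_denom_nonzero by auto
  ultimately show ?thesis unfolding norm_divide by (metis divide_self norm_eq_zero)
qed

text \<open>Disc automorphisms are isometries: write \<open>b\<close> as
  \<open>mob (- c) (mob c b)\<close> and use the composition formula, whose factor is
  unimodular.\<close>

lemma norm_mob_mob_mob:
  assumes "norm a < 1" "norm b < 1" "norm c < 1"
  shows "norm (mob (mob c a) (mob c b)) = norm (mob a b)"
proof -
  have "mob a b = mob a (mob (- c) (mob c b))"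
    using assms mob_minus_mob by auto
  also have "\<dots> = (1 - a * cnj c) / (1 - cnj a * c) * mob (mob c a) (mob c b)"
    using assms by (intro mob_mob_minus_eq) (auto intro: norm_mob_le_1)
  finally show ?thesis using norm_mob_factor[OF assms(1,3)] by (simp only: norm_mult)
qed

lemma mob_rotate:
  assumes "norm c = 1"
  shows "mob (c * a) (c * b) = c * mob a b"
proof -
  have "cnj c * c = 1" using assms by (simp add: complex_norm_square[symmetric] mult.commute)
  then have "1 - cnj (c * a) * (c * b) = 1 - cnj a * b"
    by (metis complex_cnj_mult mult.assoc mult.commute mult.right_neutral)
  then show ?thesis by (simp add: mob_def right_diff_distrib)
qed

text \<open>The second factor has modulus below 1 in the disc; it is what a square root
  gains.\<close>

lemma mob_square: "mob (a\<^sup>2) (b\<^sup>2) = mob a b * mob (- a) b"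
  unfolding mob_def by (simp add: power2_eq_square algebra_simps)

lemma norm_mob_square_less:
  assumes "norm a < 1" "norm b < 1" "a \<noteq> b"
  shows "norm (mob (a\<^sup>2) (b\<^sup>2)) < norm (mob a b)"
proof -
  have "mob a b \<noteq> 0" using assms mob_eq_0_iff by simp
  then show ?thesis
    using norm_mob_less_1[of "- a" b] assms by (simp add: mob_square norm_mult)
qed

lemma mob_has_field_derivative:
  assumes "norm a < 1" "norm z \<le> 1"
  shows "(mob a has_field_derivative (1 - a * cnj a) / (1 - cnj a * z)\<^sup>2) (at z)"
proof -
  have "1 - cnj a * z \<noteq> 0" using assms mob_denom_nonzero by blast
  then show ?thesis
    unfolding mob_def by (auto intro!: derivative_eq_intros simp: power2_eq_square algebra_simps)
qed

lemma mob_field_differentiable: "norm a < 1 \<Longrightarrow> norm z \<le> 1 \<Longrightarrow> mob a field_differentiable at z"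
  using mob_has_field_derivative field_differentiable_def by blast

lemma isCont_mob: "norm a < 1 \<Longrightarrow> norm z \<le> 1 \<Longrightarrow> isCont (mob a) z"
  using mob_has_field_derivative DERIV_isCont by blast

lemma continuous_on_mob:
  assumes "continuous_on S f" "continuous_on S g"
    "\<And>x. x \<in> S \<Longrightarrow> norm (f x) < 1" "\<And>x. x \<in> S \<Longrightarrow> norm (g x) \<le> 1"
  shows "continuous_on S (\<lambda>x. mob (f x) (g x))"
  unfolding mob_def using assms mob_denom_nonzero
  by (intro continuous_intros) auto

text \<open>The points with \<open>\<bar>mob B \<lambda>\<bar> = \<bar>\<lambda>\<bar>\<close> form the hyperbolic bisector of \<open>0\<close> and \<open>B\<close>; it is
  the arc of the circle \<open>\<bar>1 - cnj B * \<lambda>\<bar>\<^sup>2 = 1 - \<bar>B\<bar>\<^sup>2\<close> in the disc, here in polar coordinates around \<open>0\<close>.\<close>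
lemma bisector_point:
  assumes B: "B \<noteq> 0" "norm B < 1" and k: "norm k = 1" "Re k > norm B"
  obtains l where "norm l < 1" "l \<noteq> 0" "mob B l = - (cnj k)\<^sup>2 * l"
proof -
  define b where "b = norm B"
  \<comment> \<open>With \<open>cnj B * l = rho * k\<close> the circle equation reads
    \<open>rho^2 - 2 * rho * Re k + b^2 = 0\<close>. The smaller root is below \<open>b\<close>,
    which puts \<open>l\<close> inside the disc.\<close>
  define rho where "rho = Re k - sqrt ((Re k)\<^sup>2 - b\<^sup>2)"
  have b: "0 < b" "b < 1" "b < Re k" using B k by (auto simp: b_def)
  have D: "(Re k)\<^sup>2 - b\<^sup>2 > 0" using b by (simp add: power_strict_mono)
  have sq: "sqrt ((Re k)\<^sup>2 - b\<^sup>2) < Re k"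
    using b by (intro real_less_lsqrt) auto
  then have rho0: "rho > 0" by (simp add: rho_def)
  have "(Re k - b)\<^sup>2 < (Re k)\<^sup>2 - b\<^sup>2"
    using b by (simp add: power2_eq_square algebra_simps)
  then have "Re k - b < sqrt ((Re k)\<^sup>2 - b\<^sup>2)" by (rule real_less_rsqrt)
  then have rhob: "rho < b" by (simp add: rho_def)
  have eq: "b\<^sup>2 = 2 * rho * Re k - rho\<^sup>2"
  proof -
    have "(Re k - rho)\<^sup>2 = (Re k)\<^sup>2 - b\<^sup>2" using D by (simp add: rho_def)
    then show ?thesis by (simp add: power2_eq_square algebra_simps)
  qed
  define l where "l = of_real rho * k / cnj B"
  have kk: "k * cnj k = 1" using k by (simp add: complex_norm_square[symmetric])
  have BB: "B * cnj B = of_real (b\<^sup>2)" unfolding b_def by (rule complex_norm_square[symmetric])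
  have "complex_of_real (b\<^sup>2) = of_real rho * of_real (2 * Re k) - of_real (rho\<^sup>2)"
    unfolding eq by (simp add: algebra_simps)
  also have "of_real (2 * Re k) = k + cnj k" by (simp add: complex_eq_iff)
  finally have BB': "B * cnj B = of_real rho * (k + cnj k) - (of_real rho)\<^sup>2" using BB by simp
  have "norm (of_real rho * k) < 1" using rho0 rhob b k by (simp add: norm_mult)
  then have nz: "1 - of_real rho * k \<noteq> 0" by (metis eq_iff_diff_eq_0 less_irrefl norm_one)
  have cB: "cnj B \<noteq> 0" using B by simp
  have "norm l = rho / b" using rho0 k by (simp add: l_def norm_divide norm_mult b_def)
  then have l1: "norm l < 1" using rhob rho0 b by simp
  have l0: "l \<noteq> 0" using rho0 k B by (auto simp: l_def)
  have cl: "cnj B * l = of_real rho * k" using cB by (simp add: l_def)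
  have "l - B = - (cnj k)\<^sup>2 * l * (1 - of_real rho * k)"
  proof -
    have "cnj B * (l - B) = of_real rho * k - (of_real rho * (k + cnj k) - (of_real rho)\<^sup>2)"
      using cl BB' by (simp add: algebra_simps)
    also have "\<dots> = (of_real rho)\<^sup>2 - of_real rho * cnj k" by (simp add: algebra_simps)
    also have "\<dots> = (of_real rho)\<^sup>2 * (k * cnj k)\<^sup>2 - of_real rho * cnj k * (k * cnj k)" unfolding kk by simp
    also have "\<dots> = - (cnj k)\<^sup>2 * (of_real rho * k) * (1 - of_real rho * k)"
      by (simp add: power2_eq_square algebra_simps)
    also have "\<dots> = cnj B * (- (cnj k)\<^sup>2 * l * (1 - of_real rho * k))" by (simp flip: cl)
    finally show ?thesis using cB by (metis mult_left_cancel)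
  qed
  then have "mob B l = - (cnj k)\<^sup>2 * l" using nz by (simp add: mob_def cl)
  with l1 l0 that show ?thesis by blast
qed

text \<open>For \<open>A\<close> on the unit circle, numerator and denominator have the same modulus
  \<open>norm (B - A)\<close> in the limit. So a unimodular value, approached by scaling, moves
  infinitely far from every other value.\<close>

lemma norm_mob_scaled_tendsto_1:
  assumes "norm A = 1" "B \<noteq> A"
  shows "((\<lambda>r. norm (mob (of_real r * A) (of_real r * B))) \<longlongrightarrow> 1) (at_left 1)"
proof -
  have AA: "A * cnj A = 1" using assms by (simp add: complex_norm_square[symmetric])
  have eq: "1 - cnj A * B = cnj A * (A - B)" using AA by (simp add: algebra_simps)
  then have n: "norm (1 - cnj A * B) = norm (B - A)" using assms by (simp add: norm_mult norm_minus_commute)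
  have nz: "1 - cnj A * B \<noteq> 0" using n assms by auto
  have "((\<lambda>r. norm (mob (of_real r * A) (of_real r * B))) \<longlongrightarrow>
      norm ((of_real 1 * B - of_real 1 * A) / (1 - cnj (of_real 1 * A) * (of_real 1 * B)))) (at_left 1)"
    unfolding mob_def using nz by (intro tendsto_intros) auto
  then show ?thesis using n assms by (simp add: norm_divide)
qed

section \<open>Poincare distance versus pseudohyperbolic distance\<close>

lemma poincare_dist_eq: "poincare_dist a b = artanh (norm (mob b a))"
  by (simp add: poincare_dist_def Moebius_function_0_eq_mob)

lemma artanh_real_le_iff:
  fixes x y :: real
  assumes "0 \<le> x" "x < 1" "0 \<le> y" "y < 1"
  shows "artanh x \<le> artanh y \<longleftrightarrow> x \<le> y"
proof -
  have pos: "0 < (1 + x) / (1 - x)" "0 < (1 + y) / (1 - y)" using assms by auto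
  have "artanh x \<le> artanh y \<longleftrightarrow> (1 + x) / (1 - x) \<le> (1 + y) / (1 - y)"
    using pos by (simp add: artanh_def)
  also have "\<dots> \<longleftrightarrow> (1 + x) * (1 - y) \<le> (1 + y) * (1 - x)"
    using assms by (simp add: divide_le_eq pos_divide_le_eq le_divide_eq field_simps)
  also have "\<dots> \<longleftrightarrow> x \<le> y" by (simp add: algebra_simps)
  finally show ?thesis .
qed

section \<open>Complex differentiability and Schwarz's lemma on the polydisc\<close>

definition complex_differentiable :: "(complex ^ 'n \<Rightarrow> complex) \<Rightarrow> complex ^ 'n \<Rightarrow> bool" where
  "complex_differentiable f z \<longleftrightarrow>
     (\<exists>f'. (f has_derivative f') (at z) \<and> (\<forall>c v. f' (c *s v) = c * f' v))"

lemma holomorphic_Cn_iff: "holomorphic_Cn U f \<longleftrightarrow> (\<forall>z\<in>U. complex_differentiable f z)"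
  by (simp add: holomorphic_Cn_def complex_differentiable_def)

lemma holomorphic_Cn_subset: "holomorphic_Cn U f \<Longrightarrow> T \<subseteq> U \<Longrightarrow> holomorphic_Cn T f"
  by (auto simp: holomorphic_Cn_def)

lemma complex_differentiable_nth: "complex_differentiable (\<lambda>z. z $ i) z"
  unfolding complex_differentiable_def
  by (intro exI[of _ "\<lambda>v. v $ i"]) (auto intro: bounded_linear_imp_has_derivative)

lemma complex_differentiable_const: "complex_differentiable (\<lambda>z. c) z"
  unfolding complex_differentiable_def by (intro exI[of _ "\<lambda>v. 0"]) auto

lemma complex_differentiable_compose:
  assumes "complex_differentiable f z" "\<phi> field_differentiable at (f z)"
  shows "complex_differentiable (\<lambda>z. \<phi> (f z)) z"
proof -
  obtain f' where f': "(f has_derivative f') (at z)" "\<And>c v. f' (c *s v) = c * f' v"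
    using assms by (auto simp: complex_differentiable_def)
  obtain d where d: "(\<phi> has_field_derivative d) (at (f z))"
    using assms by (auto simp: field_differentiable_def)
  have "((\<lambda>z. \<phi> (f z)) has_derivative (\<lambda>v. d * f' v)) (at z)"
    using has_derivative_compose[OF f'(1)] d by (simp add: has_field_derivative_def)
  then show ?thesis unfolding complex_differentiable_def
    by (intro exI[of _ "\<lambda>v. d * f' v"]) (auto simp: f'(2))
qed

lemma complex_differentiable_add:
  assumes "complex_differentiable f z" "complex_differentiable g z"
  shows "complex_differentiable (\<lambda>z. f z + g z) z"
proof -
  obtain f' g' where "(f has_derivative f') (at z)" "\<And>c v. f' (c *s v) = c * f' v"
    "(g has_derivative g') (at z)" "\<And>c v. g' (c *s v) = c * g' v"
    using assms by (auto simp: complex_differentiable_def)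
  then show ?thesis unfolding complex_differentiable_def
    by (intro exI[of _ "\<lambda>v. f' v + g' v"]) (auto intro: has_derivative_add simp: distrib_left)
qed

lemma complex_differentiable_cmult:
  assumes "complex_differentiable f z"
  shows "complex_differentiable (\<lambda>z. c * f z) z"
  by (rule complex_differentiable_compose[OF assms, of "\<lambda>x. c * x"])
     (auto intro!: derivative_intros)

lemma complex_differentiable_mult:
  assumes "complex_differentiable f z" "complex_differentiable g z"
  shows "complex_differentiable (\<lambda>z. f z * g z) z"
proof -
  obtain f' g' where "(f has_derivative f') (at z)" "\<And>c v. f' (c *s v) = c * f' v"
    "(g has_derivative g') (at z)" "\<And>c v. g' (c *s v) = c * g' v"
    using assms by (auto simp: complex_differentiable_def)
  then show ?thesis unfolding complex_differentiable_def
    by (intro exI[of _ "\<lambda>v. f z * g' v + f' v * g z"])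
       (auto intro: has_derivative_mult simp: algebra_simps)
qed

lemma has_derivative_vecI:
  fixes r :: "'a::real_normed_vector \<Rightarrow> complex ^ 'n"
  assumes "\<And>i. ((\<lambda>z. r z $ i) has_derivative (\<lambda>v. r' v $ i)) (at z)"
  shows "(r has_derivative r') (at z)"
proof -
  have "((\<lambda>x. r x \<bullet> b) has_derivative (\<lambda>x. r' x \<bullet> b)) (at z)" if b: "b \<in> Basis" for b
  proof -
    obtain i u where "b = axis i u" using b unfolding Basis_vec_def by blast
    then show ?thesis using has_derivative_inner_left[OF assms[of i], of u]
      by (simp add: inner_axis)
  qed
  then show ?thesis using has_derivative_componentwise_within[of r r' z UNIV] by simp
qed

text \<open>The bridge to one-variable theory: complex linearity of \<open>g'\<close> turns the real
  derivative of the composite into multiplication by the number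
  \<open>g' (\<chi> i. d i)\<close>.\<close>

lemma complex_differentiable_curve:
  fixes \<gamma> :: "complex \<Rightarrow> complex ^ 'n"
  assumes "\<And>i. (\<lambda>h. \<gamma> h $ i) field_differentiable at h" "complex_differentiable g (\<gamma> h)"
  shows "(\<lambda>h. g (\<gamma> h)) field_differentiable at h"
proof -
  obtain g' where g': "(g has_derivative g') (at (\<gamma> h))" "\<And>c v. g' (c *s v) = c * g' v"
    using assms by (auto simp: complex_differentiable_def)
  have "\<forall>i. \<exists>d. ((\<lambda>h. \<gamma> h $ i) has_field_derivative d) (at h)"
    using assms by (auto simp: field_differentiable_def)
  then obtain d where d: "\<And>i. ((\<lambda>h. \<gamma> h $ i) has_field_derivative d i) (at h)" by metis
  have "(\<gamma> has_derivative (\<lambda>v. v *s (\<chi> i. d i))) (at h)"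
    by (rule has_derivative_vecI) (use d in \<open>simp add: has_field_derivative_def mult_commute_abs\<close>)
  from has_derivative_compose[OF this g'(1)]
  have "((\<lambda>h. g (\<gamma> h)) has_field_derivative g' (\<chi> i. d i)) (at h)"
    by (simp add: has_field_derivative_def g'(2) mult_commute_abs)
  then show ?thesis by (auto simp: field_differentiable_def)
qed

lemma complex_differentiable_map:
  fixes r :: "complex ^ 'n \<Rightarrow> complex ^ 'm"
  assumes "\<And>i. complex_differentiable (\<lambda>z. r z $ i) z" "complex_differentiable g (r z)"
  shows "complex_differentiable (\<lambda>z. g (r z)) z"
proof -
  obtain g' where g': "(g has_derivative g') (at (r z))" "\<And>c v. g' (c *s v) = c * g' v"
    using assms by (auto simp: complex_differentiable_def)
  have "\<forall>i. \<exists>d. ((\<lambda>z. r z $ i) has_derivative d) (at z) \<and> (\<forall>c v. d (c *s v) = c * d v)"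
    using assms by (auto simp: complex_differentiable_def)
  then obtain d where d: "\<And>i. ((\<lambda>z. r z $ i) has_derivative d i) (at z)"
    "\<And>i c v. d i (c *s v) = c * d i v" by metis
  have "(r has_derivative (\<lambda>v. \<chi> i. d i v)) (at z)"
    by (rule has_derivative_vecI) (use d in simp)
  from has_derivative_compose[OF this g'(1)]
  have "((\<lambda>z. g (r z)) has_derivative (\<lambda>v. g' (\<chi> i. d i v))) (at z)" by simp
  moreover have "(\<chi> i. d i (c *s v)) = c *s (\<chi> i. d i v)" for c v
    by (simp add: vec_eq_iff d(2))
  ultimately show ?thesis unfolding complex_differentiable_def using g'(2)
    by (intro exI[of _ "\<lambda>v. g' (\<chi> i. d i v)"]) simp
qed

lemma complex_differentiable_cong:
  assumes "complex_differentiable f z" "open W" "z \<in> W" "\<And>x. x \<in> W \<Longrightarrow> f x = g x"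
  shows "complex_differentiable g z"
proof -
  obtain f' where f': "(f has_derivative f') (at z)" "\<And>c v. f' (c *s v) = c * f' v"
    using assms by (auto simp: complex_differentiable_def)
  have "(g has_derivative f') (at z)"
    by (rule has_derivative_transform_within_open[OF f'(1) assms(2,3)]) (use assms in auto)
  with f'(2) show ?thesis by (auto simp: complex_differentiable_def)
qed

lemma complex_differentiable_continuous: "complex_differentiable f z \<Longrightarrow> isCont f z"
  unfolding complex_differentiable_def using has_derivative_continuous by blast

lemma holomorphic_Cn_continuous_on: "holomorphic_Cn U f \<Longrightarrow> continuous_on U f"
  by (meson complex_differentiable_continuous continuous_at_imp_continuous_on holomorphic_Cn_iff)

section \<open>The polydisc and the Caratheodory condition\<close>

lemma open_polydisc: "open (polydisc :: (complex ^ 'n) set)"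
proof -
  have "open {z :: complex ^ 'n. norm (z $ i) < 1}" for i
    by (intro open_Collect_less continuous_intros)
  then have "open (\<Inter>i. {z :: complex ^ 'n. norm (z $ i) < 1})" by (intro open_INT) auto
  moreover have "polydisc = (\<Inter>i. {z :: complex ^ 'n. norm (z $ i) < 1})" by (auto simp: polydisc_def)
  ultimately show ?thesis by metis
qed

lemma convex_polydisc: "convex (polydisc :: (complex ^ 'n) set)"
proof -
  have "convex ((\<lambda>z :: complex ^ 'n. z $ i) -` ball 0 1)" for i
    by (rule convex_linear_vimage) (auto intro: bounded_linear.linear)
  then have "convex (\<Inter>i. (\<lambda>z :: complex ^ 'n. z $ i) -` ball 0 1)" by (intro convex_INT) auto
  moreover have "polydisc = (\<Inter>i. (\<lambda>z :: complex ^ 'n. z $ i) -` ball 0 1)" by (auto simp: polydisc_def)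
  ultimately show ?thesis by metis
qed

lemma polydisc_nth: "z \<in> polydisc \<Longrightarrow> norm (z $ i) < 1"
  by (simp add: polydisc_def)

lemma holomorphic_on_subset_self:
  assumes "holomorphic_on_subset D D F"
  shows "holomorphic_Cn D F"
  unfolding holomorphic_Cn_iff
proof
  fix z assume "z \<in> D"
  then obtain W g where W: "open W" "z \<in> W" "W \<subseteq> D" "holomorphic_Cn W g" "\<forall>z\<in>D \<inter> W. F z = g z"
    using assms unfolding holomorphic_on_subset_def by blast
  then have "complex_differentiable g z" by (auto simp: holomorphic_Cn_iff)
  then show "complex_differentiable F z"
    by (rule complex_differentiable_cong[OF _ W(1,2)]) (use W in auto)
qed

lemma holomorphic_on_subsetI:
  assumes "holomorphic_Cn W F" "open W" "V \<subseteq> W" "W \<subseteq> D"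
  shows "holomorphic_on_subset D V F"
  using assms unfolding holomorphic_on_subset_def by blast

text \<open>An analytic disc is built coordinate by coordinate with \<open>\<gamma> 0 = w\<close>
  and \<open>\<gamma> t = z\<close>; the bound by \<open>t\<close> keeps it inside the polydisc. The
  Schwarz lemma for \<open>G\<close> along this disc, recentred at \<open>G w\<close>, gives the
  claim.\<close>

lemma disc_functions_polydisc_contract:
  fixes G :: "complex ^ 'n \<Rightarrow> complex"
  assumes G: "G \<in> disc_functions polydisc polydisc" and zw: "z \<in> polydisc" "w \<in> polydisc"
    and t: "t < 1" "\<And>i. norm (mob (w $ i) (z $ i)) \<le> t"
  shows "norm (mob (G w) (G z)) \<le> t"
proof -
  have hG: "holomorphic_Cn polydisc G" and rG: "\<And>x. x \<in> polydisc \<Longrightarrow> norm (G x) < 1"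
    using G holomorphic_on_subset_self by (auto simp: disc_functions_def)
  note zw' = zw[THEN polydisc_nth]
  have t0: "t \<ge> 0" using t(2) norm_ge_zero order_trans by blast
  show ?thesis
  proof (cases "t = 0")
    case True
    then have "mob (w $ i) (z $ i) = 0" for i using t(2)[of i] by simp
    then have "z = w" using zw' mob_eq_0_iff by (metis less_imp_le vec_eq_iff)
    then show ?thesis using True by simp
  next
    case False
    with t0 have tp: "t > 0" by simp
    define c where "c i = mob (w $ i) (z $ i) / of_real t" for i
    have c: "norm (c i) \<le> 1" for i using t(2)[of i] tp by (simp add: c_def norm_divide)
    have lc: "norm (l * c i) < 1" if "norm l < 1" for l i
      using c[of i] that mult_left_le[of "norm (c i)" "norm l"] by (simp add: norm_mult)
    define \<gamma> where "\<gamma> l = (\<chi> i. mob (- (w $ i)) (l * c i))" for l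
    have \<gamma>D: "\<gamma> l \<in> polydisc" if "norm l < 1" for l
      using lc[OF that] zw' norm_mob_less_1 by (auto simp: \<gamma>_def polydisc_def)
    define H where "H l = mob (G w) (G (\<gamma> l))" for l
    have "H holomorphic_on ball 0 1"
      unfolding holomorphic_on_def
    proof
      fix l :: complex assume "l \<in> ball 0 1"
      then have l: "norm l < 1" by simp
      have "(\<lambda>l. G (\<gamma> l)) field_differentiable at l"
      proof (rule complex_differentiable_curve)
        show "complex_differentiable G (\<gamma> l)" using hG \<gamma>D[OF l] by (simp add: holomorphic_Cn_iff)
        show "(\<lambda>h. \<gamma> h $ i) field_differentiable at l" for i
          using field_differentiable_compose[of "\<lambda>l. l * c i" l "mob (- (w $ i))"]
            mob_field_differentiable[of "- (w $ i)" "l * c i"] zw'(2)[of i] lc[OF l, of i]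
          by (simp add: \<gamma>_def o_def field_differentiable_mult)
      qed
      then have "H field_differentiable at l"
        using field_differentiable_compose[of "\<lambda>l. G (\<gamma> l)" l "mob (G w)"]
          mob_field_differentiable[of "G w" "G (\<gamma> l)"] rG[OF zw(2)] rG[OF \<gamma>D[OF l]]
        by (simp add: H_def[abs_def] o_def)
      then show "H field_differentiable at l within ball 0 1"
        by (rule field_differentiable_at_within)
    qed
    moreover have "\<gamma> 0 = w" by (simp add: \<gamma>_def vec_eq_iff)
    then have "H 0 = 0" by (simp add: H_def)
    moreover have "norm (H l) < 1" if "norm l < 1" for l
      using rG[OF zw(2)] rG[OF \<gamma>D[OF that]] norm_mob_less_1 by (simp add: H_def)
    ultimately have "norm (H (of_real t)) \<le> norm (complex_of_real t)"
      using t tp by (intro Schwarz_Lemma(1)) auto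
    moreover have "\<gamma> (of_real t) = z"
      using tp zw' mob_minus_mob by (auto simp: \<gamma>_def c_def vec_eq_iff less_imp_le)
    ultimately show ?thesis using tp by (simp add: H_def)
  qed
qed

text \<open>The form in which the Caratheodory hypothesis is used later. \<open>F\<close> is one
  competitor on \<open>V\<close>, Schwarz bounds all competitors on the polydisc, and monotonicity
  of \<open>artanh\<close> removes the suprema.\<close>

lemma caratheodory_set_contract:
  fixes V :: "(complex ^ 2) set"
  assumes "caratheodory_set polydisc V" "V \<subseteq> polydisc" and zw: "z \<in> V" "w \<in> V"
    and F: "F \<in> disc_functions polydisc V"
    and t: "t < 1" "\<And>i. norm (mob (w $ i) (z $ i)) \<le> t"
  shows "norm (mob (F w) (F z)) \<le> t"
proof -
  have zw': "z \<in> polydisc" "w \<in> polydisc" using assms by auto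
  have t0: "t \<ge> 0" using t(2) norm_ge_zero order_trans by blast
  have F1: "norm (F x) < 1" if "x \<in> V" for x using F that by (auto simp: disc_functions_def)
  have "ereal (poincare_dist (F z) (F w)) \<le> caratheodory_dist polydisc V z w"
    unfolding caratheodory_dist_def using F by (rule SUP_upper)
  also have "\<dots> = caratheodory_dist polydisc polydisc z w"
    using assms(1) zw by (simp add: caratheodory_set_def)
  also have "\<dots> \<le> ereal (artanh t)"
    unfolding caratheodory_dist_def
  proof (rule SUP_least)
    fix G assume G: "G \<in> disc_functions polydisc (polydisc :: (complex ^ 2) set)"
    then have "norm (G z) < 1" "norm (G w) < 1" using zw' by (auto simp: disc_functions_def)
    then have "norm (mob (G w) (G z)) < 1" by (intro norm_mob_less_1)
    then show "ereal (poincare_dist (G z) (G w)) \<le> ereal (artanh t)"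
      using disc_functions_polydisc_contract[OF G zw' t] t0 t
      by (simp add: poincare_dist_eq artanh_real_le_iff)
  qed
  finally show ?thesis
    using t0 t norm_mob_less_1[OF F1[OF zw(2)] F1[OF zw(1)]]
    by (simp add: poincare_dist_eq artanh_real_le_iff)
qed

text \<open>Composition with \<open>r\<close> extends a function from \<open>V\<close> to
  \<open>D\<close> without changing its values on \<open>V\<close>, and restriction goes the other
  way, so both suprema run over the same numbers.\<close>

lemma holomorphic_retract_imp_caratheodory_set:
  fixes D :: "(complex ^ 'n) set"
  assumes "open D" "holomorphic_retract D V"
  shows "caratheodory_set D V"
proof -
  obtain r where r: "holomorphic_map D r" "r ` D \<subseteq> D" "r ` D = V" "\<And>z. z \<in> V \<Longrightarrow> r z = z"
    using assms by (auto simp: holomorphic_retract_def)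
  have VD: "V \<subseteq> D" using r by auto
  have rd: "complex_differentiable (\<lambda>z. r z $ i) x" if "x \<in> D" for x i
    using r(1) that by (auto simp: holomorphic_map_def holomorphic_Cn_iff)
  have rc: "isCont r x" if "x \<in> D" for x
  proof -
    have "((\<lambda>y. \<chi> i. r y $ i) \<longlongrightarrow> (\<chi> i. r x $ i)) (at x)"
      using complex_differentiable_continuous[OF rd[OF that]]
      by (intro tendsto_vec_lambda) (simp add: isCont_def)
    then show ?thesis by (simp add: isCont_def)
  qed
  have 1: "(\<lambda>z. F (r z)) \<in> disc_functions D D" if F: "F \<in> disc_functions D V" for F
    unfolding disc_functions_def
  proof (intro CollectI conjI)
    have "F ` V \<subseteq> ball 0 1" using F by (simp add: disc_functions_def)
    then show "(\<lambda>z. F (r z)) ` D \<subseteq> ball 0 1" using r(3) by blast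
    have "complex_differentiable (\<lambda>z. F (r z)) x" if x: "x \<in> D" for x
    proof -
      have "r x \<in> V" using x r by auto
      then obtain W g where W: "open W" "r x \<in> W" "holomorphic_Cn W g" "\<forall>z\<in>V \<inter> W. F z = g z"
        using F unfolding disc_functions_def holomorphic_on_subset_def by blast
      have "complex_differentiable (\<lambda>z. g (r z)) x"
      proof (rule complex_differentiable_map)
        show "complex_differentiable (\<lambda>z. r z $ i) x" for i by (rule rd[OF x])
        show "complex_differentiable g (r x)" using W(2,3) by (simp add: holomorphic_Cn_iff)
      qed
      moreover have "open (r -` W \<inter> D)"
        using W(1) assms(1) rc continuous_on_open_vimage[of D r] continuous_at_imp_continuous_on[of D r]
        by blast
      ultimately show ?thesis
      proof (rule complex_differentiable_cong)
        show "x \<in> r -` W \<inter> D" using W(2) x by simp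
        show "g (r y) = F (r y)" if "y \<in> r -` W \<inter> D" for y
          using W(4) that r(3) by (metis IntD1 IntD2 IntI imageI vimageD)
      qed
    qed
    then show "holomorphic_on_subset D D (\<lambda>z. F (r z))"
      using assms(1) by (intro holomorphic_on_subsetI) (auto simp: holomorphic_Cn_iff)
  qed
  have 2: "F \<in> disc_functions D V" if F: "F \<in> disc_functions D D" for F
    using F VD holomorphic_on_subsetI[OF holomorphic_on_subset_self assms(1) VD order_refl]
    unfolding disc_functions_def by auto
  show ?thesis unfolding caratheodory_set_def
  proof (intro ballI antisym)
    fix z w assume zw: "z \<in> V" "w \<in> V"
    show "caratheodory_dist D D z w \<le> caratheodory_dist D V z w"
      unfolding caratheodory_dist_def using 2 by (intro SUP_subset_mono) auto
    show "caratheodory_dist D V z w \<le> caratheodory_dist D D z w"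
      unfolding caratheodory_dist_def
    proof (rule SUP_least)
      fix F assume "F \<in> disc_functions D V"
      then show "ereal (poincare_dist (F z) (F w)) \<le>
          (SUP F\<in>disc_functions D D. ereal (poincare_dist (F z) (F w)))"
        using SUP_upper[OF 1, of F "\<lambda>F. ereal (poincare_dist (F z) (F w))"] zw r(4) by simp
    qed
  qed
qed

text \<open>On a disconnected \<open>V\<close> a locally constant function may take the values
  \<open>s\<close> and 0. Points of the polydisc have distance \<open>t < 1\<close>, so any
  \<open>s\<close> between \<open>t\<close> and 1 violates contraction.\<close>

lemma caratheodory_set_connected:
  fixes V :: "(complex ^ 2) set"
  assumes C: "caratheodory_set polydisc V" and VD: "V \<subseteq> polydisc"
  shows "connected V"
proof (rule ccontr)
  assume "\<not> connected V"
  then obtain A B where AB: "open A" "open B" "V \<subseteq> A \<union> B" "A \<inter> B \<inter> V = {}" "A \<inter> V \<noteq> {}" "B \<inter> V \<noteq> {}"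
    unfolding connected_def by blast
  obtain z w where z: "z \<in> A" "z \<in> V" and w: "w \<in> B" "w \<in> V" using AB by blast
  define t where "t = Max (range (\<lambda>i. norm (mob (w $ i) (z $ i))))"
  have t: "norm (mob (w $ i) (z $ i)) \<le> t" for i unfolding t_def by (intro Max_ge) auto
  have "t \<in> range (\<lambda>i. norm (mob (w $ i) (z $ i)))" unfolding t_def by (intro Max_in) auto
  then obtain i where i: "t = norm (mob (w $ i) (z $ i))" by blast
  have zw: "z \<in> polydisc" "w \<in> polydisc" using z w VD by auto
  then have t1: "t < 1" unfolding i by (intro norm_mob_less_1 polydisc_nth)
  have "0 \<le> t" using t norm_ge_zero order_trans by blast
  then obtain s where s: "t < s" "s < 1" "0 < s" using dense[OF t1] by auto
  define F where "F x = (if x \<in> A then complex_of_real s else 0)" for x :: "complex ^ 2"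
  have "holomorphic_on_subset polydisc V F"
    unfolding holomorphic_on_subset_def
  proof
    fix x assume x: "x \<in> V"
    show "\<exists>W g. open W \<and> x \<in> W \<and> W \<subseteq> polydisc \<and> holomorphic_Cn W g \<and> (\<forall>z\<in>V \<inter> W. F z = g z)"
    proof (cases "x \<in> A")
      case True
      then show ?thesis using AB(1) VD x open_polydisc
        by (intro exI[of _ "A \<inter> polydisc"] exI[of _ "\<lambda>_. of_real s"])
           (auto simp: F_def holomorphic_Cn_iff complex_differentiable_const)
    next
      case False
      then show ?thesis using AB VD x open_polydisc
        by (intro exI[of _ "B \<inter> polydisc"] exI[of _ "\<lambda>_. 0"])
           (auto simp: F_def holomorphic_Cn_iff complex_differentiable_const)
    qed
  qed
  then have "F \<in> disc_functions polydisc V" using s by (auto simp: disc_functions_def F_def)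
  from caratheodory_set_contract[OF C VD z(2) w(2) this t1 t]
  have "norm (mob (F w) (F z)) \<le> t" .
  moreover have "w \<notin> A" using AB w by blast
  ultimately show False using s z by (simp add: F_def)
qed

section \<open>Balanced pairs\<close>

lemma type2_cases:
  fixes i k j :: 2
  assumes "i \<noteq> k"
  shows "j = i \<or> j = k"
  using assms exhaust_2 by metis

text \<open>The index is a parameter so that each argument about \<open>i\<close> and
  \<open>k\<close> also covers the case with the coordinates exchanged.\<close>

definition pt :: "2 \<Rightarrow> complex \<Rightarrow> complex \<Rightarrow> complex ^ 2" where
  "pt i a b = (\<chi> j. if j = i then a else b)"

lemma pt_nth [simp]: "pt i a b $ i = a" "k \<noteq> i \<Longrightarrow> pt i a b $ k = b"
  by (simp_all add: pt_def)

lemma pt_eqI: "i \<noteq> k \<Longrightarrow> v $ i = a \<Longrightarrow> v $ k = b \<Longrightarrow> pt i a b = v"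
  by (auto simp: vec_eq_iff pt_def dest: type2_cases)

lemma pt_nth_nth: "i \<noteq> k \<Longrightarrow> pt i (v $ i) (v $ k) = v"
  by (rule pt_eqI) auto

lemma scale_pt: "h *s pt i a b = pt i (h * a) (h * b)"
  by (simp add: vec_eq_iff pt_def)

lemma norm_pt_le: "norm (pt i a b) \<le> norm a + norm b"
proof -
  obtain k where k: "i \<noteq> k" by (metis exhaust_2 zero_neq_one one_neq_zero num1_eq_iff zero_neq_numeral)
  have U: "(UNIV :: 2 set) = {i, k}" using type2_cases[OF k] by auto
  have "norm (pt i a b) \<le> (\<Sum>j\<in>UNIV. norm (pt i a b $ j))"
    unfolding norm_vec_def by (rule L2_set_le_sum) simp
  also have "\<dots> = norm a + norm b" unfolding U using k by simp
  finally show ?thesis .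
qed

lemma pt_in_polydisc: "norm a < 1 \<Longrightarrow> norm b < 1 \<Longrightarrow> pt i a b \<in> polydisc"
  by (simp add: polydisc_def pt_def)

lemma polynomial_Cn_complex_differentiable:
  fixes p :: "complex ^ 'n \<Rightarrow> complex"
  assumes "polynomial_Cn p"
  shows "complex_differentiable p z"
proof -
  have pow: "complex_differentiable (\<lambda>z. (z $ i) ^ n) z" for i n
    by (rule complex_differentiable_compose[OF complex_differentiable_nth]) (auto intro: derivative_intros)
  have prod: "complex_differentiable (\<lambda>z. \<Prod>i\<in>I. (z $ i) ^ \<alpha> i) z" if "finite I" for I and \<alpha> :: "'n \<Rightarrow> nat"
    using that by induction (auto intro: complex_differentiable_const complex_differentiable_mult pow)
  have sum: "complex_differentiable (\<lambda>z. \<Sum>\<alpha>\<in>A. c \<alpha> * (\<Prod>i\<in>UNIV. (z $ i) ^ \<alpha> i)) z"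
    if "finite A" for A and c :: "('n \<Rightarrow> nat) \<Rightarrow> complex"
    using that
  proof induction
    case (insert \<beta> A)
    have "complex_differentiable (\<lambda>z. c \<beta> * (\<Prod>i\<in>UNIV. (z $ i) ^ \<beta> i)) z"
      by (intro complex_differentiable_cmult prod) simp
    from complex_differentiable_add[OF this insert.IH] show ?case using insert.hyps by simp
  qed (simp add: complex_differentiable_const)
  show ?thesis using assms sum by (auto simp: polynomial_Cn_def)
qed

text \<open>Strict convexity of the closed disc, from the parallelogram law.\<close>

lemma midpoint_eq_1:
  fixes p q l :: complex
  assumes "norm p \<le> 1" "norm q \<le> 1" "norm l = 1" "(p + q) / 2 = l"
  shows "p = l" "q = l"
proof -
  have "(norm (p - q))\<^sup>2 + (norm (p + q))\<^sup>2 = 2 * (norm p)\<^sup>2 + 2 * (norm q)\<^sup>2"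
    unfolding cmod_power2 by (simp add: power2_eq_square algebra_simps)
  moreover have "p + q = 2 * l" using assms(4) by (simp add: field_simps)
  then have "(norm (p + q))\<^sup>2 = 4" using assms(3) by (simp add: norm_mult)
  moreover have "(norm p)\<^sup>2 \<le> 1" "(norm q)\<^sup>2 \<le> 1" using assms by (simp_all add: power_le_one)
  ultimately have "(norm (p - q))\<^sup>2 \<le> 0" by linarith
  then have "p = q" by simp
  then show "p = l" "q = l" using \<open>p + q = 2 * l\<close> by auto
qed

lemma closure_polydisc_nth:
  assumes "V \<subseteq> polydisc" "x \<in> closure V"
  shows "norm (x $ i) \<le> 1"
proof -
  have "closed {x. norm (x $ i) \<le> 1}" by (intro closed_Collect_le continuous_intros)
  moreover have "V \<subseteq> {x. norm (x $ i) \<le> 1}" using assms polydisc_nth by (auto intro: less_imp_le)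
  ultimately show ?thesis using assms closure_minimal by blast
qed

lemma compact_closure_subset_polydisc:
  fixes V :: "(complex ^ 'n) set"
  assumes "V \<subseteq> polydisc"
  shows "compact (closure V)"
proof -
  have "norm x \<le> (\<Sum>i\<in>(UNIV :: 'n set). 1)" if "x \<in> V" for x
  proof -
    have "norm x \<le> (\<Sum>j\<in>UNIV. norm (x $ j))"
      unfolding norm_vec_def by (rule L2_set_le_sum) simp
    also have "\<dots> \<le> (\<Sum>i\<in>(UNIV :: 'n set). 1)"
      using that assms polydisc_nth by (intro sum_mono) (auto intro: less_imp_le)
    finally show ?thesis .
  qed
  then have "bounded V" unfolding bounded_iff by blast
  then show ?thesis by simp
qed

text \<open>If a boundary point of the disc through \<open>z\<close> and \<open>w\<close> is missing from the closure of \<open>V\<close>, the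
  average \<open>u\<close> of the two extremal functions for \<open>z, w\<close> maps \<open>V\<close> into a slit disc, and there the square
  root of a Moebius transform of \<open>u\<close> separates \<open>z\<close> and \<open>w\<close> better than \<open>u\<close> does.\<close>
lemma balanced_boundary_in_closure:
  fixes V :: "(complex ^ 2) set"
  assumes C: "caratheodory_set polydisc V" and VD: "V \<subseteq> polydisc" and ik: "i \<noteq> k"
    and zw: "z \<in> V" "w \<in> V" "z \<noteq> w"
    and c: "norm c = 1" "mob (z $ k) (w $ k) = c * mob (z $ i) (w $ i)"
    and l0: "norm l0 = 1"
  shows "pt i (mob (- (z $ i)) l0) (mob (- (z $ k)) (c * l0)) \<in> closure V"
proof (rule ccontr)
  define a b t where "a = z $ i" "b = z $ k" "t = mob a (w $ i)"
  note abt = this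
  assume "\<not> ?thesis"
  then have notin: "pt i (mob (- a) l0) (mob (- b) (c * l0)) \<notin> closure V" by (simp add: abt)
  have a1: "norm a < 1" and b1: "norm b < 1" and w1: "norm (w $ i) < 1" "norm (w $ k) < 1"
    using zw VD polydisc_nth by (auto simp: abt)
  have cc: "c * cnj c = 1" using c by (simp add: complex_norm_square[symmetric])
  have t1: "norm t < 1" unfolding abt using a1 w1 norm_mob_less_1 by (simp add: abt)
  have t0: "t \<noteq> 0"
  proof
    assume "t = 0"
    then have "w $ i = a" "w $ k = b"
      using mob_eq_0_iff a1 b1 w1 c(2) by (auto simp: abt less_imp_le)
    then show False using zw ik pt_nth_nth by (metis abt(1,2))
  qed
  \<comment> \<open>The factor \<open>cnj c\<close> makes both summands 0 at \<open>z\<close> and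
    \<open>t\<close> at \<open>w\<close>, so the average keeps the extremal distance of the
    pair.\<close>
  define u where "u x = (mob a (x $ i) + cnj c * mob b (x $ k)) / 2" for x :: "complex ^ 2"
  have uz: "u z = 0" by (simp add: u_def abt)
  have uw: "u w = t" using c(2) cc by (simp add: u_def abt mult.commute[of c] flip: mult.assoc)
  have u_diff: "complex_differentiable u x" if "norm (x $ i) \<le> 1" "norm (x $ k) \<le> 1" for x
  proof -
    have "complex_differentiable (\<lambda>x. mob a (x $ i)) x"
      by (rule complex_differentiable_compose[OF complex_differentiable_nth])
         (use that a1 mob_field_differentiable in auto)
    moreover have "complex_differentiable (\<lambda>x. mob b (x $ k)) x"
      by (rule complex_differentiable_compose[OF complex_differentiable_nth])
         (use that b1 mob_field_differentiable in auto)
    ultimately have "complex_differentiable (\<lambda>x. (1/2) * (mob a (x $ i) + cnj c * mob b (x $ k))) x"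
      by (intro complex_differentiable_cmult complex_differentiable_add)
    then show ?thesis by (simp add: u_def[abs_def])
  qed
  have u1: "norm (u x) < 1" if "x \<in> polydisc" for x
  proof -
    have "norm (mob a (x $ i)) < 1" "norm (mob b (x $ k)) < 1"
      using that polydisc_nth a1 b1 norm_mob_less_1 by blast+
    then have "norm (mob a (x $ i) + cnj c * mob b (x $ k)) < 2"
      using norm_triangle_ineq[of "mob a (x $ i)" "cnj c * mob b (x $ k)"] c by (simp add: norm_mult)
    then show ?thesis by (simp add: u_def norm_divide)
  qed
  have "compact (u ` closure V)"
  proof (rule compact_continuous_image)
    show "compact (closure V)" using VD by (rule compact_closure_subset_polydisc)
    show "continuous_on (closure V) u"
      using u_diff complex_differentiable_continuous closure_polydisc_nth[OF VD]
      by (intro continuous_at_imp_continuous_on) blast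
  qed
  \<comment> \<open>By strict convexity, on the closed bidisc the value \<open>l0\<close> is taken
    only at the point assumed missing.\<close>
  moreover have "l0 \<notin> u ` closure V"
  proof
    assume "l0 \<in> u ` closure V"
    then obtain x where x: "x \<in> closure V" "u x = l0" by blast
    have xn: "norm (x $ i) \<le> 1" "norm (x $ k) \<le> 1" using closure_polydisc_nth[OF VD x(1)] by auto
    have n: "norm (mob a (x $ i)) \<le> 1" "norm (cnj c * mob b (x $ k)) \<le> 1"
      using xn a1 b1 norm_mob_le_1 c by (auto simp: norm_mult)
    have "mob a (x $ i) = l0" "cnj c * mob b (x $ k) = l0"
      using midpoint_eq_1[OF n l0] x(2) by (auto simp: u_def)
    then have e: "mob a (x $ i) = l0" "mob b (x $ k) = c * l0"
      using cc by (metis mult.assoc mult.left_neutral)+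
    have "x $ i = mob (- a) l0" "x $ k = mob (- b) (c * l0)"
      using mob_minus_mob[OF a1 xn(1)] mob_minus_mob[OF b1 xn(2)] e by auto
    then show False using notin x(1) pt_eqI[OF ik] by metis
  qed
  ultimately obtain \<delta> where \<delta>: "\<delta> > 0" "\<And>x. x \<in> closure V \<Longrightarrow> \<delta> \<le> dist l0 (u x)"
    using separate_point_closed[of "u ` closure V" l0] compact_imp_closed by blast
  \<comment> \<open>Since \<open>1 - r < \<delta>\<close>, the rotated function \<open>u'\<close>
    omits the segment \<open>[r, 1)\<close> on \<open>V\<close>; the bound 1/2 keeps
    \<open>r\<close> positive.\<close>
  define r where "r = max (1/2) (1 - \<delta> / 2)"
  have r: "0 < r" "r < 1" "1 - r < \<delta>" using \<delta>(1) by (auto simp: r_def)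
  have nr: "norm (complex_of_real r) < 1" using r by simp
  define u' where "u' x = cnj l0 * u x" for x
  \<comment> \<open>\<open>mob r\<close> carries \<open>[r, 1)\<close> onto \<open>[0, 1)\<close>,
    and the sign turns this into \<open>(- 1, 0]\<close>; hence \<open>M\<close> avoids the branch
    cut of \<open>csqrt\<close> on \<open>V\<close>.\<close>
  define M where "M x = - mob (of_real r) (u' x)" for x
  have u'1: "norm (u' x) < 1" if "x \<in> polydisc" for x using u1[OF that] l0 by (simp add: u'_def norm_mult)
  have M1: "norm (M x) < 1" if "x \<in> polydisc" for x
    using norm_mob_less_1[OF nr u'1[OF that]] by (simp add: M_def)
  have M_diff: "complex_differentiable M x" if "x \<in> polydisc" for x
  proof -
    have "complex_differentiable u' x"
      unfolding u'_def[abs_def] using polydisc_nth[OF that]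
      by (intro complex_differentiable_cmult u_diff less_imp_le)
    then have "complex_differentiable (\<lambda>x. mob (of_real r) (u' x)) x"
      by (rule complex_differentiable_compose)
         (use mob_field_differentiable[OF nr] u'1[OF that] in \<open>auto intro: less_imp_le\<close>)
    then have "complex_differentiable (\<lambda>x. (-1) * mob (of_real r) (u' x)) x"
      by (rule complex_differentiable_cmult)
    then show ?thesis by (simp add: M_def[abs_def])
  qed
  have slit: "M x \<notin> \<real>\<^sub>\<le>\<^sub>0" if x: "x \<in> V" for x
  proof
    assume "M x \<in> \<real>\<^sub>\<le>\<^sub>0"
    then obtain s where s: "M x = of_real s" "s \<le> 0" by (auto elim!: nonpos_Reals_cases)
    have xp: "x \<in> polydisc" using x VD by auto
    have "u' x = mob (- of_real r) (mob (of_real r) (u' x))"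
      using mob_minus_mob[OF nr] u'1[OF xp] by (simp add: less_imp_le)
    also have "mob (of_real r) (u' x) = of_real (- s)" using s(1) by (simp add: M_def minus_equation_iff)
    also have "mob (- of_real r) (of_real (- s)) = of_real ((- s + r) / (1 + r * (- s)))"
      by (simp add: mob_def)
    finally have ux: "u' x = of_real ((- s + r) / (1 + r * (- s)))" .
    have den: "1 + r * (- s) > 0" using mult_nonneg_nonneg[of r "- s"] r s by linarith
    have "r * (1 + r * (- s)) \<le> - s + r"
    proof -
      have "r * r * (- s) \<le> 1 * (- s)" using r s by (intro mult_right_mono) (auto simp: mult_le_one)
      then show ?thesis by (simp add: algebra_simps)
    qed
    then have ge: "(- s + r) / (1 + r * (- s)) \<ge> r" using den by (simp add: le_divide_eq)
    have "norm (u' x) < 1" using u'1[OF xp] .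
    then have lt: "(- s + r) / (1 + r * (- s)) < 1" using ux by (simp only: norm_of_real)
    have "dist l0 (u x) = norm (cnj l0 * l0 - u' x)"
      using l0 by (simp add: u'_def dist_norm norm_mult flip: right_diff_distrib)
    also have "cnj l0 * l0 = 1" using l0 by (simp add: complex_norm_square[symmetric] mult.commute)
    also have "norm (1 - u' x) = \<bar>1 - (- s + r) / (1 + r * (- s))\<bar>"
      unfolding ux by (metis norm_of_real of_real_1 of_real_diff)
    also have "\<dots> < \<delta>" using ge lt r(3) by linarith
    finally show False using \<delta>(2)[of x] x closure_subset by fastforce
  qed
  define F where "F x = csqrt (M x)" for x
  define W where "W = polydisc \<inter> M -` (- \<real>\<^sub>\<le>\<^sub>0)"
  have "open W"
  proof -
    have "continuous_on polydisc M"
      using M_diff by (intro holomorphic_Cn_continuous_on) (simp add: holomorphic_Cn_iff)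
    then show ?thesis
      unfolding W_def by (intro continuous_open_preimage open_polydisc open_Compl closed_nonpos_Reals_complex)
  qed
  moreover have "holomorphic_Cn W F"
    unfolding holomorphic_Cn_iff
  proof
    fix x assume "x \<in> W"
    then have "complex_differentiable M x" "M x \<notin> \<real>\<^sub>\<le>\<^sub>0" using M_diff by (auto simp: W_def)
    then show "complex_differentiable F x"
      using complex_differentiable_compose[OF _ field_differentiable_at_csqrt, of M x]
      by (simp add: F_def[abs_def])
  qed
  moreover have "V \<subseteq> W" using slit VD by (auto simp: W_def)
  ultimately have "holomorphic_on_subset polydisc V F"
    by (intro holomorphic_on_subsetI[of W]) (auto simp: W_def)
  moreover have F2: "(F x)\<^sup>2 = M x" for x by (simp add: F_def)
  have F1: "norm (F x) < 1" if "x \<in> V" for x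
  proof -
    have "(norm (F x))\<^sup>2 < 1\<^sup>2" using M1[of x] that VD F2[of x] by (metis norm_power one_power2 subsetD)
    then show ?thesis by (rule power_less_imp_less_base) simp
  qed
  ultimately have "F \<in> disc_functions polydisc V" by (auto simp: disc_functions_def)
  moreover have "norm (mob (w $ j) (z $ j)) \<le> norm t" for j
    using type2_cases[OF ik, of j] c norm_mob_commute[of "w $ j"] by (auto simp: abt norm_mult)
  ultimately have le: "norm (mob (F w) (F z)) \<le> norm t"
    using caratheodory_set_contract[OF C VD zw(1,2)] t1 by blast
  \<comment> \<open>Rotations and \<open>mob r\<close> are isometries, so \<open>M\<close> still
    separates \<open>z\<close> and \<open>w\<close> by exactly \<open>norm t\<close>; its root
    \<open>F\<close> would do strictly better.\<close>
  have "norm (mob (M w) (M z)) = norm (mob (mob (of_real r) (u' w)) (mob (of_real r) (u' z)))"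
    using mob_rotate[of "-1" "mob (of_real r) (u' w)" "mob (of_real r) (u' z)"] by (simp add: M_def)
  also have "\<dots> = norm (mob (u' w) (u' z))"
    using u'1 zw VD by (intro norm_mob_mob_mob nr) auto
  also have "\<dots> = norm (mob (u w) (u z))"
    using mob_rotate[of "cnj l0"] l0 by (simp add: u'_def norm_mult)
  also have "\<dots> = norm t" by (simp add: uz uw)
  finally have eq: "norm (mob ((F w)\<^sup>2) ((F z)\<^sup>2)) = norm t" by (simp add: F2)
  then have "F w \<noteq> F z" using t0 by auto
  then show False using norm_mob_square_less[of "F w" "F z"] F1 zw eq le by auto
qed

text \<open>By the maximum principle a polynomial on this analytic disc is bounded by its values on
  the boundary circle, which lies in \<open>closure V\<close>. So no polynomial can separate a point
  of the disc from \<open>V\<close>.\<close>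

lemma balanced_pair_disc:
  fixes V :: "(complex ^ 2) set"
  assumes C: "caratheodory_set polydisc V" and VD: "V \<subseteq> polydisc"
    and PC: "polynomially_convex_in polydisc V" and ik: "i \<noteq> k"
    and zw: "z \<in> V" "w \<in> V" "z \<noteq> w"
    and c: "norm c = 1" "mob (z $ k) (w $ k) = c * mob (z $ i) (w $ i)"
    and l: "norm l < 1"
  shows "pt i (mob (- (z $ i)) l) (mob (- (z $ k)) (c * l)) \<in> V"
proof (rule ccontr)
  define \<gamma> where "\<gamma> l = pt i (mob (- (z $ i)) l) (mob (- (z $ k)) (c * l))" for l
  assume "\<not> ?thesis"
  then have nV: "\<gamma> l \<notin> V" by (simp add: \<gamma>_def)
  have z1: "norm (- (z $ j)) < 1" for j using zw VD polydisc_nth by auto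
  have "\<gamma> l \<in> polydisc"
    unfolding \<gamma>_def using z1 l c by (intro pt_in_polydisc norm_mob_less_1) (auto simp: norm_mult)
  then obtain p where p: "polynomial_Cn p" "ereal (norm (p (\<gamma> l))) > (SUP w\<in>V. ereal (norm (p w)))"
    using PC nV unfolding polynomially_convex_in_def by blast
  have up: "ereal (norm (p v)) \<le> (SUP w\<in>V. ereal (norm (p w)))" if "v \<in> V" for v
    using that by (rule SUP_upper)
  \<comment> \<open>Below a real number by the choice of \<open>p\<close> and at least
    \<open>norm (p z)\<close>, the supremum is finite.\<close>
  obtain B where B: "(SUP w\<in>V. ereal (norm (p w))) = ereal B"
    using p(2) up[OF zw(1)] by (cases "SUP w\<in>V. ereal (norm (p w))") auto
  have pV: "norm (p v) \<le> B" if "v \<in> V" for v using up[OF that] B by simp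
  have pc: "continuous_on S p" for S
    using polynomial_Cn_complex_differentiable[OF p(1)] complex_differentiable_continuous
    by (intro continuous_at_imp_continuous_on) blast
  have pK: "norm (p v) \<le> B" if "v \<in> closure V" for v
    using continuous_on_closure_norm_le[OF pc _ that] pV by blast
  have diff: "(\<lambda>l. p (\<gamma> l)) field_differentiable at m" if m: "norm m \<le> 1" for m
  proof (rule complex_differentiable_curve)
    show "complex_differentiable p (\<gamma> m)" by (rule polynomial_Cn_complex_differentiable[OF p(1)])
    fix j
    have 1: "mob (- (z $ i)) field_differentiable at m" by (rule mob_field_differentiable[OF z1 m])
    have "mob (- (z $ k)) field_differentiable at (c * m)"
      using m c by (intro mob_field_differentiable[OF z1]) (simp add: norm_mult)
    then have 2: "(\<lambda>m. mob (- (z $ k)) (c * m)) field_differentiable at m"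
      using field_differentiable_compose[of "\<lambda>m. c * m" m "mob (- (z $ k))"]
      by (simp add: o_def field_differentiable_mult)
    show "(\<lambda>h. \<gamma> h $ j) field_differentiable at m"
      using type2_cases[OF ik, of j] 1 2 ik by (auto simp: \<gamma>_def)
  qed
  have "norm (p (\<gamma> l)) \<le> B"
  proof (rule maximum_modulus_frontier[of "\<lambda>l. p (\<gamma> l)" "cball 0 1"])
    show "(\<lambda>l. p (\<gamma> l)) holomorphic_on interior (cball 0 1)"
      using diff by (auto simp: holomorphic_on_def intro: field_differentiable_at_within)
    show "continuous_on (closure (cball 0 1)) (\<lambda>l. p (\<gamma> l))"
      using diff by (auto intro!: continuous_at_imp_continuous_on field_differentiable_imp_continuous_at)
    show "norm (p (\<gamma> m)) \<le> B" if "m \<in> frontier (cball 0 1)" for m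
    proof (rule pK)
      have "norm m = 1" using that by simp
      then show "\<gamma> m \<in> closure V"
        unfolding \<gamma>_def by (rule balanced_boundary_in_closure[OF C VD ik zw c])
    qed
  qed (use l in auto)
  then show False using p(2) B by simp
qed

section \<open>Tangent slopes of zero sets\<close>

text \<open>On the complex line through a point of \<open>N\<close> and \<open>y\<close> this is the
  one-variable identity theorem; convexity of \<open>U\<close> makes its trace on the line
  connected.\<close>

lemma holomorphic_Cn_convex_identity:
  fixes g :: "complex ^ 'n \<Rightarrow> complex"
  assumes hg: "holomorphic_Cn U g" and U: "open U" "convex U"
    and N: "open N" "N \<inter> U \<noteq> {}" "\<And>y. y \<in> N \<inter> U \<Longrightarrow> g y = 0" and y: "y \<in> U"
  shows "g y = 0"
proof -
  obtain p where p: "p \<in> N" "p \<in> U" using N by blast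
  define L where "L l = p + l *s (y - p)" for l :: complex
  have Lnth: "L l $ i = p $ i + l * (y $ i - p $ i)" for l i by (simp add: L_def algebra_simps)
  have contL: "continuous_on UNIV L"
  proof -
    have "isCont (\<lambda>l. \<chi> i. p $ i + l * (y $ i - p $ i)) l" for l
      unfolding isCont_def by (intro tendsto_vec_lambda tendsto_intros)
    moreover have "(\<lambda>l. \<chi> i. p $ i + l * (y $ i - p $ i)) = L" by (auto simp: vec_eq_iff Lnth)
    ultimately show ?thesis by (simp add: continuous_at_imp_continuous_on)
  qed
  have op: "open (L -` S)" if "open S" for S
    using continuous_on_open_vimage[of UNIV L] contL that by auto
  have conv: "convex (L -` U)"
  proof (rule convexI)
    fix a b :: complex and u v :: real
    assume ab: "a \<in> L -` U" "b \<in> L -` U" "0 \<le> u" "0 \<le> v" "u + v = 1"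
    have "L (u *\<^sub>R a + v *\<^sub>R b) = u *\<^sub>R L a + v *\<^sub>R L b"
    proof -
      have "p $ i + (u *\<^sub>R a + v *\<^sub>R b) * (y $ i - p $ i) =
          u *\<^sub>R (p $ i + a * (y $ i - p $ i)) + v *\<^sub>R (p $ i + b * (y $ i - p $ i))" for i
      proof -
        have "p $ i = (u + v) *\<^sub>R p $ i" using ab by simp
        then have "p $ i = u *\<^sub>R p $ i + v *\<^sub>R p $ i" by (simp only: scaleR_left_distrib)
        then show ?thesis by (simp add: scaleR_conv_of_real algebra_simps)
      qed
      then show ?thesis by (simp add: vec_eq_iff Lnth)
    qed
    then show "u *\<^sub>R a + v *\<^sub>R b \<in> L -` U"
      using convexD[OF U(2), of "L a" "L b" u v] ab by simp
  qed
  have holL: "(\<lambda>l. g (L l)) holomorphic_on L -` U"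
  proof -
    have "(\<lambda>l. g (L l)) field_differentiable at l" if "L l \<in> U" for l
    proof (rule complex_differentiable_curve)
      show "complex_differentiable g (L l)" using hg that by (simp add: holomorphic_Cn_iff)
      show "(\<lambda>h. L h $ i) field_differentiable at l" for i
        unfolding Lnth by (auto intro!: derivative_intros)
    qed
    then show ?thesis by (auto simp: holomorphic_on_def intro: field_differentiable_at_within)
  qed
  have L01: "L 0 = p" "L 1 = y" by (auto simp: L_def)
  have "g (L 1) = 0"
  proof (rule analytic_continuation_open[of "L -` (N \<inter> U)" "L -` U" "\<lambda>l. g (L l)" "\<lambda>_. 0"])
    show "open (L -` (N \<inter> U))" "open (L -` U)" using op U(1) N(1) by auto
    show "L -` (N \<inter> U) \<noteq> {}" using L01 p by (metis IntI empty_iff vimageI2)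
    show "connected (L -` U)" using conv by (rule convex_connected)
    show "1 \<in> L -` U" using L01 y by simp
  qed (use N(3) holL in auto)
  then show ?thesis using L01 by simp
qed

text \<open>The limit slopes of the zero set of \<open>g\<close> at \<open>x\<close> are zeros of the lowest-order coefficient in the
  expansion of \<open>h \<mapsto> g (x + h *s pt i 1 s)\<close>, which depends holomorphically on \<open>s\<close>.\<close>
lemma infinitely_many_tangent_slopes:
  fixes g :: "complex ^ 2 \<Rightarrow> complex"
  assumes hg: "holomorphic_Cn (ball x r) g" and r: "r > 0" and ik: "i \<noteq> k"
    and S: "infinite S" "bounded S"
    and lim: "\<And>s e. s \<in> S \<Longrightarrow> e > 0 \<Longrightarrow>
        \<exists>h s'. 0 < norm h \<and> norm h < e \<and> norm (s' - s) < e \<and> g (x + h *s pt i 1 s') = 0"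
    and y: "y \<in> ball x r"
  shows "g y = 0"
proof -
  obtain R0 where R0: "R0 > 0" "\<And>s. s \<in> S \<Longrightarrow> norm s \<le> R0" using S(2) bounded_pos by blast
  \<comment> \<open>The margin 1 keeps slopes \<open>s'\<close> near \<open>S\<close> in range and
    gives \<open>R > 1\<close> for the set \<open>N\<close> below.\<close>
  define R where "R = R0 + 1"
  have R: "R > 1" "R0 < R" using R0 by (auto simp: R_def)
  \<comment> \<open>Makes all points with \<open>norm h \<le> d\<close> and
    \<open>norm s \<le> R\<close> lie in the closed ball of radius \<open>r / 2\<close>, where
    \<open>g\<close> is bounded.\<close>
  define d where "d = r / 2 / (1 + R)"
  have d: "d > 0" using r R by (simp add: d_def)
  define G where "G h s = g (x + h *s pt i 1 s)" for h s
  have inK: "x + h *s pt i 1 s \<in> cball x (r / 2)" if "norm h \<le> d" "norm s \<le> R" for h s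
  proof -
    have "norm (h *s pt i 1 s) \<le> norm h + norm h * norm s"
      unfolding scale_pt using norm_pt_le[of i "h * 1" "h * s"] by (simp add: norm_mult)
    also have "\<dots> = norm h * (1 + norm s)" by (simp add: algebra_simps)
    also have "\<dots> \<le> d * (1 + R)" using that d by (intro mult_mono) auto
    also have "\<dots> = r / 2" using R unfolding d_def by (intro nonzero_eq_divide_eq[THEN iffD1]) auto
    finally show ?thesis by (simp add: dist_norm)
  qed
  have sub: "cball x (r / 2) \<subseteq> ball x r" using r by auto
  have gd: "complex_differentiable g (x + h *s pt i 1 s)" if "norm h \<le> d" "norm s \<le> R" for h s
    using inK[OF that] sub hg by (auto simp: holomorphic_Cn_iff)
  have "compact (g ` cball x (r / 2))"
    using holomorphic_Cn_continuous_on[OF hg] sub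
    by (intro compact_continuous_image) (auto intro: continuous_on_subset)
  then obtain B where B: "B > 0" "\<And>y. y \<in> cball x (r / 2) \<Longrightarrow> norm (g y) \<le> B"
    using compact_imp_bounded bounded_pos by (metis imageI)
  have GB: "norm (G h s) \<le> B" if "norm h \<le> d" "norm s \<le> R" for h s
    using B(2)[OF inK[OF that]] by (simp add: G_def)
  have Gh: "(\<lambda>h. G h s) field_differentiable at h" if "norm h \<le> d" "norm s \<le> R" for h s
    unfolding G_def
  proof (rule complex_differentiable_curve)
    show "complex_differentiable g (x + h *s pt i 1 s)" by (rule gd[OF that])
    show "(\<lambda>h. (x + h *s pt i 1 s) $ j) field_differentiable at h" for j
      unfolding vector_add_component vector_smult_component by (intro derivative_intros)
  qed
  have Gs: "(\<lambda>s. G h s) field_differentiable at s" if "norm h \<le> d" "norm s \<le> R" for h s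
    unfolding G_def
  proof (rule complex_differentiable_curve)
    show "complex_differentiable g (x + h *s pt i 1 s)" by (rule gd[OF that])
    fix j
    show "(\<lambda>s. (x + h *s pt i 1 s) $ j) field_differentiable at s"
      using type2_cases[OF ik, of j] ik by (auto intro!: derivative_intros)
  qed
  define A where "A j s = (deriv ^^ j) (\<lambda>h. G h s) 0 / fact j" for j s
  have hol: "(\<lambda>h. G h s) holomorphic_on ball 0 d" "continuous_on (cball 0 d) (\<lambda>h. G h s)"
    if "norm s \<le> R" for s
    using field_differentiable_at_within[OF Gh[OF _ that]]
      continuous_at_imp_continuous_on[of "cball 0 d", OF ballI,
        OF field_differentiable_imp_continuous_at[OF Gh[OF _ that]]]
    by (simp_all add: holomorphic_on_def)
  have AB: "norm (A j s) \<le> B / d ^ j" if s: "norm s \<le> R" for j s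
  proof -
    have "norm ((deriv ^^ j) (\<lambda>h. G h s) 0) \<le> fact j * B / d ^ j"
      by (rule Cauchy_inequality[OF hol[OF s] d]) (use GB s in auto)
    then show ?thesis by (simp add: A_def norm_divide divide_le_eq mult.commute)
  qed
  have sums: "(\<lambda>j. A j s * h ^ j) sums G h s" if "norm h < d" "norm s \<le> R" for h s
    using holomorphic_power_series[OF hol(1)[OF that(2)], of h] that by (simp add: A_def)
  \<comment> \<open>Cauchy's estimate bounds the coefficients by \<open>B / d ^ j\<close>. For
    \<open>norm h \<le> d / 2\<close> the tail from order \<open>Suc m\<close> on is dominated by a
    geometric series of ratio 1/2, whence the factor 2.\<close>
  define K where "K m = 2 * B / d ^ Suc m" for m
  have K: "K m > 0" for m using B d by (simp add: K_def)
  have rem: "norm (G h s - A m s * h ^ m) \<le> K m * norm h ^ Suc m"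
    if h: "norm h \<le> d / 2" and s: "norm s \<le> R" and z: "\<And>j. j < m \<Longrightarrow> A j s = 0" for h s m
  proof -
    have "(\<Sum>j<Suc m. A j s * h ^ j) = A m s * h ^ m" using z by simp
    then have 1: "(\<lambda>j. A (j + Suc m) s * h ^ (j + Suc m)) sums (G h s - A m s * h ^ m)"
      using sums_iff_shift[of "\<lambda>j. A j s * h ^ j" "Suc m"] sums[of h s] h s d by auto
    have 2: "(\<lambda>j. B / d ^ Suc m * norm h ^ Suc m * (1/2) ^ j) sums (B / d ^ Suc m * norm h ^ Suc m * 2)"
      using geometric_sums[of "1/2 :: real"] by (intro sums_mult) simp
    have "norm (A (j + Suc m) s * h ^ (j + Suc m)) \<le> B / d ^ Suc m * norm h ^ Suc m * (1/2) ^ j" for j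
    proof -
      have "norm (A (j + Suc m) s * h ^ (j + Suc m)) \<le> B / d ^ (j + Suc m) * norm h ^ (j + Suc m)"
        unfolding norm_mult norm_power by (intro mult_right_mono AB s) simp
      also have "\<dots> = B / d ^ Suc m * norm h ^ Suc m * (norm h / d) ^ j"
        by (simp add: power_add power_divide mult_ac)
      also have "\<dots> \<le> B / d ^ Suc m * norm h ^ Suc m * (1/2) ^ j"
        using h d B by (intro mult_left_mono power_mono) (auto simp: divide_le_eq)
      finally show ?thesis .
    qed
    from norm_sums_le[OF 1 2 this] show ?thesis by (simp add: K_def mult_ac)
  qed
  \<comment> \<open>Once the lower coefficients vanish, \<open>G h s / h ^ m\<close> tends to
    \<open>A m s\<close> uniformly in \<open>s\<close>, so \<open>A m\<close> is holomorphic. It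
    vanishes on \<open>S\<close>, which accumulates inside the disc, hence everywhere.\<close>
  have A0: "\<forall>s\<in>ball 0 R. A m s = 0" for m
  proof (induction m rule: less_induct)
    case (less m)
    then have z: "A j s = 0" if "j < m" "norm s < R" for j s using that by auto
    define h where "h n = complex_of_real (d / 2 / real (Suc n))" for n
    have hn: "norm (h n) = d / 2 / real (Suc n)" for n unfolding h_def norm_of_real using d by simp
    have "norm (h n) > 0" for n unfolding hn using d by simp
    moreover have "norm (h n) \<le> d / 2" for n unfolding hn using d by (simp add: divide_le_eq)
    ultimately have h: "norm (h n) \<le> d / 2" "h n \<noteq> 0" for n by auto
    have h0: "(\<lambda>n. K m * norm (h n)) \<longlonglongrightarrow> 0"
      unfolding hn by (intro tendsto_mult_right_zero) (rule LIMSEQ_Suc[OF lim_const_over_n])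
    have ul: "uniform_limit (ball 0 R) (\<lambda>n s. G (h n) s / h n ^ m) (A m) sequentially"
    proof (rule uniform_limitI)
      fix e :: real assume "e > 0"
      then have "\<forall>\<^sub>F n in sequentially. K m * norm (h n) < e" using h0 order_tendstoD(2) by blast
      then show "\<forall>\<^sub>F n in sequentially. \<forall>s\<in>ball 0 R. dist (G (h n) s / h n ^ m) (A m s) < e"
      proof eventually_elim
        case (elim n)
        show ?case
        proof
          fix s :: complex assume "s \<in> ball 0 R"
          then have s: "norm s < R" by simp
          have "dist (G (h n) s / h n ^ m) (A m s) = norm (G (h n) s - A m s * h n ^ m) / norm (h n) ^ m"
            using h(2) by (simp add: dist_norm norm_power[symmetric] norm_divide[symmetric] diff_divide_distrib)
          also have "\<dots> \<le> K m * norm (h n) ^ Suc m / norm (h n) ^ m"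
            using rem[OF h(1)] s z by (intro divide_right_mono) auto
          also have "\<dots> = K m * norm (h n)" using h(2) by simp
          finally show "dist (G (h n) s / h n ^ m) (A m s) < e" using elim by simp
        qed
      qed
    qed
    have Ahol: "A m holomorphic_on ball 0 R"
    proof (rule holomorphic_uniform_sequence[OF open_ball])
      show "(\<lambda>s. G (h n) s / h n ^ m) holomorphic_on ball 0 R" for n
        unfolding holomorphic_on_def
      proof
        fix s :: complex assume "s \<in> ball 0 R"
        then have "(\<lambda>s. G (h n) s) field_differentiable at s within ball 0 R"
          using h(1)[of n] d by (intro field_differentiable_at_within[OF Gs]) auto
        from field_differentiable_divide[OF this field_differentiable_const[of "h n ^ m"]]
        show "(\<lambda>s. G (h n) s / h n ^ m) field_differentiable at s within ball 0 R"
          using h(2) by simp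
      qed
      fix s :: complex assume "s \<in> ball 0 R"
      then obtain \<epsilon> where "\<epsilon> > 0" "cball s \<epsilon> \<subseteq> ball 0 R" by (meson open_ball open_contains_cball)
      then show "\<exists>\<epsilon>>0. cball s \<epsilon> \<subseteq> ball 0 R \<and> uniform_limit (cball s \<epsilon>) (\<lambda>n s. G (h n) s / h n ^ m) (A m) sequentially"
        using uniform_limit_on_subset[OF ul] by blast
    qed
    \<comment> \<open>At a zero of \<open>g\<close> the leading term cancels the remainder, so
      \<open>A m s'\<close> is at most of the size of \<open>h\<close>; slopes \<open>s'\<close>
      close to \<open>s\<close> then force \<open>A m s = 0\<close>.\<close>
    have AS: "A m s = 0" if s: "s \<in> S" for s
    proof (rule ccontr)
      assume "A m s \<noteq> 0"
      define \<eta> where "\<eta> = norm (A m s) / 2"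
      have \<eta>: "\<eta> > 0" "\<eta> < norm (A m s)" using \<open>A m s \<noteq> 0\<close> by (auto simp: \<eta>_def)
      have sR: "s \<in> ball 0 R" using R0(2)[OF s] R by simp
      have "isCont (A m) s"
        using holomorphic_on_imp_continuous_on[OF Ahol] sR by (simp add: continuous_on_eq_continuous_at)
      then have "(\<lambda>s. norm (A m s)) \<midarrow>s\<rightarrow> norm (A m s)" unfolding isCont_def by (rule tendsto_norm)
      then have "\<forall>\<^sub>F s' in at s. norm (A m s') > \<eta>" using \<eta>(2) order_tendstoD(1) by blast
      then obtain e0 where e0: "e0 > 0" "\<And>s'. s' \<noteq> s \<Longrightarrow> dist s' s < e0 \<Longrightarrow> norm (A m s') > \<eta>"
        unfolding eventually_at by auto
      \<comment> \<open>In order: continuity of \<open>A m\<close> at \<open>s\<close>,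
        \<open>s'\<close> in the range of slopes, \<open>h\<close> in the range of the remainder
        estimate, and a remainder quotient below \<eta>.\<close>
      define e where "e = min (min e0 (R - R0)) (min (d / 2) (\<eta> / K m))"
      have e: "e > 0" using e0 R d \<eta> K by (simp add: e_def)
      obtain h s' where hs: "0 < norm h" "norm h < e" "norm (s' - s) < e" "g (x + h *s pt i 1 s') = 0"
        using lim[OF s e] by blast
      have "norm s' < R"
        using hs(3) R0(2)[OF s] norm_triangle_ineq2[of s' s] by (simp add: e_def)
      moreover have "G h s' = 0" using hs by (simp add: G_def)
      moreover have "norm h \<le> d / 2" using hs(2) by (simp add: e_def)
      ultimately have "norm (A m s') * norm h ^ m \<le> K m * norm h * norm h ^ m"
        using rem[of h s' m] z by (simp add: norm_mult norm_power mult.assoc)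
      then have "norm (A m s') \<le> K m * norm h" using hs(1) by simp
      also have "\<dots> < \<eta>" using hs(2) K[of m] by (simp add: e_def field_simps)
      finally have "norm (A m s') < \<eta>" .
      moreover have "norm (A m s') > \<eta>"
        using e0(2)[of s'] \<eta>(2) hs(3) by (cases "s' = s") (auto simp: e_def dist_norm)
      ultimately show False by simp
    qed
    have "\<exists>s\<in>cball 0 R0. s islimpt S"
      using S(1) R0(2) by (intro Heine_Borel_imp_Bolzano_Weierstrass) auto
    then obtain s0 where "s0 \<in> cball 0 R0" "s0 islimpt S" by blast
    then have "A m s = 0" if "s \<in> ball 0 R" for s
      using analytic_continuation[OF Ahol, of S s0 s] AS R0(2) R that by fastforce
    then show ?case by blast
  qed
  have G0: "G h s = 0" if "norm h < d" "norm s < R" for h s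
  proof -
    have "(\<lambda>j. A j s * h ^ j) = (\<lambda>_. 0)" using A0 that by auto
    then show ?thesis using sums[of h s] that sums_unique2 sums_zero by (metis less_imp_le)
  qed
  \<comment> \<open>Points reached with bounded slopes do not fill a neighbourhood of
    \<open>x\<close>. \<open>N\<close> is an open set of them: there \<open>norm h > d / 4\<close>
    exceeds the numerator of the slope, so \<open>norm s < 1\<close>.\<close>
  define N where "N = {y. norm (y $ i - x $ i - of_real (d / 2)) < d / 4 \<and> norm (y $ k - x $ k) < d / 4}"
  have "open N" unfolding N_def
    by (intro open_Collect_conj open_Collect_less continuous_intros)
  moreover have "x + of_real (d / 2) *s pt i 1 0 \<in> N \<inter> ball x r"
  proof -
    have "x + of_real (d / 2) *s pt i 1 0 \<in> ball x r"
      using inK[of "of_real (d / 2)" 0] sub d R by auto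
    then show ?thesis using d ik by (simp add: N_def)
  qed
  moreover have "g y = 0" if "y \<in> N" for y
  proof -
    define h where "h = y $ i - x $ i"
    define s where "s = (y $ k - x $ k) / h"
    have yN: "norm (h - of_real (d / 2)) < d / 4" "norm (y $ k - x $ k) < d / 4"
      using that by (auto simp: N_def h_def)
    have n2: "norm (complex_of_real (d / 2)) = d / 2" using d by simp
    have h: "norm h < d" "norm h > d / 4"
      using yN(1) norm_triangle_ineq2[of h "of_real (d / 2)"] norm_triangle_ineq2[of "of_real (d / 2)" h] n2 d
      by (auto simp: norm_minus_commute)
    have "norm s < 1" using yN(2) h d by (simp add: s_def norm_divide divide_less_eq)
    then have "G h s = 0" using G0 h R by auto
    moreover have "x + h *s pt i 1 s = y"
    proof -
      have "h \<noteq> 0" using h d by auto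
      then have "h *s pt i 1 s = y - x"
        unfolding scale_pt by (intro pt_eqI[OF ik]) (auto simp: h_def s_def)
      then show ?thesis by simp
    qed
    ultimately show ?thesis by (simp add: G_def)
  qed
  ultimately show ?thesis
    using holomorphic_Cn_convex_identity[OF hg open_ball convex_ball, of N y] y by blast
qed

text \<open>Near a point of \<open>D\<close> in the closure of the interior, the defining functions
  vanish on a nonempty open set, hence on a ball. So the interior is both open and closed relative
  to \<open>D\<close>.\<close>

lemma analytic_subvariety_interior:
  fixes V :: "(complex ^ 'n) set"
  assumes V: "analytic_subvariety D V" and D: "open D" "connected D" and ne: "interior V \<noteq> {}"
  shows "V = D"
proof -
  have clV: "closedin (top_of_set D) V" using V by (simp add: analytic_subvariety_def)
  then have VD: "V \<subseteq> D" by (rule closedin_imp_subset)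
  have int: "x \<in> interior V" if x: "x \<in> D" "x \<in> closure (interior V)" for x
  proof -
    obtain T where T: "closed T" "V = D \<inter> T" using clV closedin_closed by metis
    have "closure (interior V) \<subseteq> T" using T interior_subset[of V] by (intro closure_minimal) auto
    then have "x \<in> V" using x T by auto
    then obtain U F where U: "open U" "x \<in> U" "\<forall>f\<in>F. holomorphic_Cn U f" "V \<inter> U = {z\<in>U. \<forall>f\<in>F. f z = 0}"
      using V unfolding analytic_subvariety_def by blast
    obtain r where r: "r > 0" "ball x r \<subseteq> U" using U open_contains_ball by blast
    have N: "interior V \<inter> ball x r \<noteq> {}"
      using x(2) r(1) by (meson centre_in_ball closure_iff_nhds_not_empty open_ball subset_refl open_Int_closure_eq_empty inf_commute disjoint_iff)
    have "f y = 0" if f: "f \<in> F" and y: "y \<in> ball x r" for f y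
    proof (rule holomorphic_Cn_convex_identity[OF _ open_ball convex_ball open_interior N _ y])
      show "holomorphic_Cn (ball x r) f" using U(3) f r(2) holomorphic_Cn_subset by blast
      show "f v = 0" if "v \<in> interior V \<inter> ball x r" for v
      proof -
        have "v \<in> V \<inter> U" using that interior_subset r(2) by blast
        then show ?thesis using U(4) f by simp
      qed
    qed
    then have "ball x r \<subseteq> V" using U(4) r(2) by blast
    then show ?thesis using r(1) by (meson centre_in_ball interior_maximal open_ball subsetD)
  qed
  have "interior V \<inter> D = {} \<or> - closure (interior V) \<inter> D = {}"
  proof (rule connectedD[OF D(2)])
    show "open (interior V)" "open (- closure (interior V))" by auto
    show "interior V \<inter> - closure (interior V) \<inter> D = {}" using closure_subset by blast
    show "D \<subseteq> interior V \<union> - closure (interior V)" using int by blast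
  qed
  moreover have "interior V \<inter> D \<noteq> {}" using ne VD interior_subset by blast
  ultimately have "D \<subseteq> closure (interior V)" by blast
  then have "D \<subseteq> V" using int interior_subset by blast
  then show ?thesis using VD by blast
qed

lemma infinitely_many_tangent_slopes_interior:
  fixes V :: "(complex ^ 2) set"
  assumes V: "analytic_subvariety D V" and x: "x \<in> V" and ik: "i \<noteq> k"
    and S: "infinite S" "bounded S"
    and lim: "\<And>s e. s \<in> S \<Longrightarrow> e > 0 \<Longrightarrow>
        \<exists>h s'. 0 < norm h \<and> norm h < e \<and> norm (s' - s) < e \<and> x + h *s pt i 1 s' \<in> V"
  shows "x \<in> interior V"
proof -
  obtain U F where U: "open U" "x \<in> U" "\<forall>f\<in>F. holomorphic_Cn U f" "V \<inter> U = {z\<in>U. \<forall>f\<in>F. f z = 0}"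
    using V x unfolding analytic_subvariety_def by blast
  obtain r where r: "r > 0" "ball x r \<subseteq> U" using U open_contains_ball by blast
  obtain L where L: "L > 0" "\<And>s. s \<in> S \<Longrightarrow> norm s \<le> L" using S(2) bounded_pos by blast
  have "f y = 0" if f: "f \<in> F" and y: "y \<in> ball x r" for f y
  proof (rule infinitely_many_tangent_slopes[OF _ r(1) ik S _ y])
    show "holomorphic_Cn (ball x r) f" using U(3) f r(2) holomorphic_Cn_subset by blast
    fix s and e :: real
    assume s: "s \<in> S" and e: "e > 0"
    \<comment> \<open>\<open>L + 2\<close> bounds \<open>1 + norm s'\<close>, so the point stays in
      the ball where the defining functions live.\<close>
    define e' where "e' = min (min e 1) (r / (L + 2))"
    have "e' > 0" using e r L by (simp add: e'_def)
    then obtain h s' where hs: "0 < norm h" "norm h < e'" "norm (s' - s) < e'" "x + h *s pt i 1 s' \<in> V"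
      using lim[OF s] by blast
    have s': "norm s' \<le> L + 1" using hs(3) L(2)[OF s] norm_triangle_ineq2[of s' s] by (simp add: e'_def)
    have "norm (h *s pt i 1 s') \<le> norm h * (1 + norm s')"
      unfolding scale_pt using norm_pt_le[of i "h * 1" "h * s'"] by (simp add: norm_mult algebra_simps)
    also have "\<dots> \<le> norm h * (L + 2)" using s' by (intro mult_left_mono) auto
    also have "\<dots> < r" using hs(2) L(1) by (simp add: e'_def pos_less_divide_eq)
    finally have "x + h *s pt i 1 s' \<in> U" using r(2) by (auto simp: dist_norm)
    then have "f (x + h *s pt i 1 s') = 0" using U(4) hs(4) f by auto
    then show "\<exists>h s'. 0 < norm h \<and> norm h < e \<and> norm (s' - s) < e \<and> f (x + h *s pt i 1 s') = 0"
      using hs by (intro exI[of _ h] exI[of _ s']) (simp add: e'_def)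
  qed
  then have "ball x r \<subseteq> V" using U(4) r(2) by blast
  then show ?thesis using r(1) by (meson centre_in_ball interior_maximal open_ball subsetD)
qed

text \<open>Punctured balls are connected, so near 0 the function \<open>q\<close> passes through
  all small distances from a cluster value that is not its limit; each such distance yields another
  cluster value. Meant for difference quotients.\<close>

lemma bounded_not_convergent_infinite_cluster:
  fixes q :: "complex \<Rightarrow> complex"
  assumes cont: "continuous_on (ball 0 \<rho> - {0}) q" and \<rho>: "\<rho> > 0"
    and bd: "\<And>h. h \<in> ball 0 \<rho> - {0} \<Longrightarrow> norm (q h) \<le> L"
    and nc: "\<And>l. \<not> (q \<longlongrightarrow> l) (at 0)"
  obtains S where "infinite S" "bounded S"
    "\<And>s e. s \<in> S \<Longrightarrow> e > 0 \<Longrightarrow> \<exists>h. h \<in> ball 0 \<rho> - {0} \<and> norm h < e \<and> norm (q h - s) < e"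
proof -
  define S where "S = {s. norm s \<le> L \<and>
     (\<forall>e>0. \<exists>h. h \<in> ball 0 \<rho> - {0} \<and> norm h < e \<and> norm (q h - s) < e)}"
  \<comment> \<open>Used with \<open>C = UNIV\<close> to get a first cluster value \<alpha>, and
    with \<open>C = {\<tau>}\<close> to get one at distance \<tau> from it.\<close>
  have cluster: "\<exists>s\<in>S. \<phi> s \<in> C"
    if C: "closed C" and \<phi>: "continuous_on UNIV \<phi>"
      and h: "\<And>n. h n \<in> ball 0 \<rho> - {0} \<and> norm (h n) < inverse (real (Suc n)) \<and> \<phi> (q (h n)) \<in> C"
    for \<phi> :: "complex \<Rightarrow> real" and C h
  proof -
    have "\<forall>n. q (h n) \<in> cball 0 L" using h bd by simp
    then obtain s \<sigma> where s: "s \<in> cball 0 L" "strict_mono \<sigma>" "((\<lambda>n. q (h n)) \<circ> \<sigma>) \<longlonglongrightarrow> s"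
      using compact_cball compact_imp_seq_compact seq_compactE by metis
    have "\<exists>h'. h' \<in> ball 0 \<rho> - {0} \<and> norm h' < e \<and> norm (q h' - s) < e" if "e > 0" for e
    proof -
      have "\<forall>\<^sub>F n in sequentially. dist (q (h (\<sigma> n))) s < e"
        using s(3) that by (auto dest: tendstoD simp: o_def)
      moreover have "\<forall>\<^sub>F n in sequentially. inverse (real (Suc n)) < e"
        using LIMSEQ_inverse_real_of_nat that order_tendstoD(2) by blast
      ultimately have "\<forall>\<^sub>F n in sequentially. dist (q (h (\<sigma> n))) s < e \<and> inverse (real (Suc n)) < e"
        by (rule eventually_conj)
      then obtain n where n: "dist (q (h (\<sigma> n))) s < e" "inverse (real (Suc n)) < e"
        using eventually_happens by (metis (mono_tags, lifting) sequentially_bot)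
      have "inverse (real (Suc (\<sigma> n))) \<le> inverse (real (Suc n))"
        using seq_suble[OF s(2), of n] by (intro le_imp_inverse_le) auto
      then have "norm (h (\<sigma> n)) < e" using n(2) h[of "\<sigma> n"] by linarith
      then show ?thesis using n(1) h[of "\<sigma> n"] by (intro exI[of _ "h (\<sigma> n)"]) (auto simp: dist_norm)
    qed
    then have "s \<in> S" using s(1) by (simp add: S_def)
    moreover have "(\<lambda>n. \<phi> (q (h (\<sigma> n)))) \<longlonglongrightarrow> \<phi> s"
      using \<phi> s(3) by (intro isCont_tendsto_compose[of s \<phi>])
        (auto simp: continuous_on_eq_continuous_at o_def)
    then have "\<phi> s \<in> C" using C h closed_sequentially by metis
    ultimately show ?thesis by blast
  qed
  have small: "\<exists>h::complex. h \<in> ball 0 \<rho> - {0} \<and> norm h < e" if "e > 0" for e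
    using \<rho> that by (intro exI[of _ "of_real (min e \<rho> / 2)"]) auto
  have "\<forall>n. \<exists>h::complex. h \<in> ball 0 \<rho> - {0} \<and> norm h < inverse (real (Suc n)) \<and> 0 \<in> (UNIV :: real set)"
    using small by simp
  then obtain h0 :: "nat \<Rightarrow> complex" where "\<And>n. h0 n \<in> ball 0 \<rho> - {0} \<and> norm (h0 n) < inverse (real (Suc n)) \<and> 0 \<in> (UNIV :: real set)"
    by metis
  then obtain \<alpha> where \<alpha>: "\<alpha> \<in> S" using cluster[of UNIV "\<lambda>_. 0" h0] by auto
  obtain \<epsilon> where \<epsilon>: "\<epsilon> > 0" "\<And>\<delta>. \<delta> > 0 \<Longrightarrow> \<exists>h. h \<noteq> 0 \<and> norm h < \<delta> \<and> norm (q h - \<alpha>) \<ge> \<epsilon>"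
    using nc[of \<alpha>] unfolding LIM_eq by (simp add: not_less) (meson leD)
  have level: "\<exists>h. h \<in> ball 0 \<rho> - {0} \<and> norm h < e \<and> norm (q h - \<alpha>) = \<tau>"
    if \<tau>: "0 < \<tau>" "\<tau> < \<epsilon>" and e: "e > 0" for \<tau> e
  proof -
    define m where "m = min e \<rho>"
    have m: "m > 0" using e \<rho> by (simp add: m_def)
    define P where "P = (\<lambda>h. norm (q h - \<alpha>)) ` (ball 0 m - {0})"
    have "connected P" unfolding P_def
    proof (rule connected_continuous_image)
      show "connected (ball (0 :: complex) m - {0})" by (rule connected_punctured_ball) simp
      have "continuous_on (ball 0 m - {0}) q"
        using cont by (rule continuous_on_subset) (auto simp: m_def)
      then show "continuous_on (ball 0 m - {0}) (\<lambda>h. norm (q h - \<alpha>))" by (intro continuous_intros)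
    qed
    moreover have "min m \<tau> > 0" using m \<tau>(1) by simp
    then have "\<exists>h. h \<in> ball 0 \<rho> - {0} \<and> norm h < min m \<tau> \<and> norm (q h - \<alpha>) < min m \<tau>"
      using \<alpha> unfolding S_def mem_Collect_eq by blast
    then obtain h1 where "h1 \<in> ball 0 \<rho> - {0}" "norm h1 < min m \<tau>" "norm (q h1 - \<alpha>) < min m \<tau>"
      by blast
    then have "norm (q h1 - \<alpha>) \<in> P" "norm (q h1 - \<alpha>) \<le> \<tau>" by (auto simp: P_def)
    moreover obtain h2 where "h2 \<noteq> 0" "norm h2 < m" "norm (q h2 - \<alpha>) \<ge> \<epsilon>" using \<epsilon>(2)[OF m] by blast
    then have "norm (q h2 - \<alpha>) \<in> P" "\<tau> \<le> norm (q h2 - \<alpha>)" using \<tau> by (auto simp: P_def)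
    ultimately have "\<tau> \<in> P" using connectedD_interval by blast
    then show ?thesis by (auto simp: P_def m_def)
  qed
  have "{0<..<\<epsilon>} \<subseteq> (\<lambda>s. norm (s - \<alpha>)) ` S"
  proof
    fix \<tau> assume "\<tau> \<in> {0<..<\<epsilon>}"
    then have "\<forall>n. \<exists>h. h \<in> ball 0 \<rho> - {0} \<and> norm h < inverse (real (Suc n)) \<and> norm (q h - \<alpha>) \<in> {\<tau>}"
      using level by simp
    then obtain h where "\<And>n. h n \<in> ball 0 \<rho> - {0} \<and> norm (h n) < inverse (real (Suc n)) \<and> norm (q (h n) - \<alpha>) \<in> {\<tau>}"
      by metis
    then have "\<exists>s\<in>S. norm (s - \<alpha>) \<in> {\<tau>}"
      by (intro cluster[where h = h]) (auto intro!: continuous_intros)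
    then show "\<tau> \<in> (\<lambda>s. norm (s - \<alpha>)) ` S" by auto
  qed
  moreover have "infinite {0<..<\<epsilon>}" using \<epsilon>(1) by (rule infinite_Ioo)
  ultimately have "infinite S" using finite_subset by blast
  moreover have "bounded S" unfolding bounded_iff S_def by blast
  ultimately show thesis by (rule that) (simp add: S_def)
qed

section \<open>Pairs off the diagonal and the sign of the distance difference\<close>

text \<open>Every remaining point lies on a cross, one row and one column, that avoids the removed
  point and contains \<open>(x1, y1)\<close>.\<close>

lemma connected_Times_minus_point:
  fixes X :: "'a::topological_space set" and Y :: "'b::topological_space set"
  assumes "connected X" "connected Y" "x1 \<in> X" "x1 \<noteq> x0" "y1 \<in> Y" "y1 \<noteq> y0"
  shows "connected (X \<times> Y - {(x0, y0)})"
proof -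
  have row: "connected ({x} \<times> Y)" for x using assms by (intro connected_Times) auto
  have col: "connected (X \<times> {y})" for y using assms by (intro connected_Times) auto
  define T where "T = (\<lambda>x. {x} \<times> Y \<union> X \<times> {y1}) ` (X - {x0}) \<union> (\<lambda>y. X \<times> {y} \<union> {x1} \<times> Y) ` (Y - {y0})"
  have "connected (\<Union>T)"
  proof (rule connected_Union)
    show "connected s" if "s \<in> T" for s
      using that assms unfolding T_def by (auto intro!: connected_Un row col)
    have "(x1, y1) \<in> \<Inter>T" using assms by (auto simp: T_def)
    then show "\<Inter>T \<noteq> {}" by blast
  qed
  moreover have "\<Union>T = X \<times> Y - {(x0, y0)}"
  proof
    show "\<Union>T \<subseteq> X \<times> Y - {(x0, y0)}" using assms by (auto simp: T_def)
    show "X \<times> Y - {(x0, y0)} \<subseteq> \<Union>T"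
    proof
      fix p assume "p \<in> X \<times> Y - {(x0, y0)}"
      then obtain x y where p: "p = (x, y)" "x \<in> X" "y \<in> Y" "x \<noteq> x0 \<or> y \<noteq> y0" by auto
      show "p \<in> \<Union>T"
      proof (cases "x = x0")
        case True
        then have "X \<times> {y} \<union> {x1} \<times> Y \<in> T" using p by (simp add: T_def)
        then show ?thesis using p by blast
      next
        case False
        then have "{x} \<times> Y \<union> X \<times> {y1} \<in> T" using p by (simp add: T_def)
        then show ?thesis using p by blast
      qed
    qed
  qed
  ultimately show ?thesis by simp
qed

text \<open>If \<open>z\<close> had partners of both kinds, the connected sets of such partners would form a connected set
  of pairs on which the difference of the two distances changes sign without vanishing.\<close>
lemma no_balanced_pair_dichotomy:
  fixes V :: "(complex ^ 2) set"
  assumes V: "connected V" and VD: "V \<subseteq> polydisc"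
    and nb: "\<And>z w. z \<in> V \<Longrightarrow> w \<in> V \<Longrightarrow> z \<noteq> w \<Longrightarrow>
      norm (mob (z $ i) (w $ i)) \<noteq> norm (mob (z $ k) (w $ k))"
  shows "(\<forall>z\<in>V. \<forall>w\<in>V. z \<noteq> w \<longrightarrow> norm (mob (z $ k) (w $ k)) < norm (mob (z $ i) (w $ i))) \<or>
    (\<forall>z\<in>V. \<forall>w\<in>V. z \<noteq> w \<longrightarrow> norm (mob (z $ i) (w $ i)) < norm (mob (z $ k) (w $ k)))"
proof -
  define \<phi> where "\<phi> z w = norm (mob (z $ i) (w $ i)) - norm (mob (z $ k) (w $ k))" for z w :: "complex ^ 2"
  have sym: "\<phi> z w = \<phi> w z" for z w by (simp add: \<phi>_def norm_mob_commute)
  have V1: "norm (v $ j) < 1" if "v \<in> V" for v j using that VD polydisc_nth by auto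
  have nz: "\<phi> z w \<noteq> 0" if "z \<in> V" "w \<in> V" "z \<noteq> w" for z w using nb[OF that] by (simp add: \<phi>_def)
  have cont: "continuous_on (V \<times> V) (\<lambda>p. \<phi> (fst p) (snd p))"
    unfolding \<phi>_def by (intro continuous_intros continuous_on_mob) (auto simp: V1 less_imp_le[OF V1])
  have one: "\<not> (\<phi> z a > 0 \<and> \<phi> z b < 0)" if z: "z \<in> V" and ab: "a \<in> V" "b \<in> V" for z a b
  proof
    assume c: "\<phi> z a > 0 \<and> \<phi> z b < 0"
    have z0: "\<phi> z z = 0" by (simp add: \<phi>_def)
    have contz: "continuous_on V (\<phi> z)"
      unfolding \<phi>_def using z
      by (intro continuous_intros continuous_on_mob) (auto simp: V1 less_imp_le[OF V1])
    define A where "A = {w\<in>V. \<phi> z w > 0}"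
    define B where "B = {w\<in>V. \<phi> z w < 0}"
    have contz': "continuous_on (V - {z}) (\<phi> z)" using contz by (rule continuous_on_subset) auto
    have opA: "openin (top_of_set (V - {z})) A"
    proof -
      have "A = (V - {z}) \<inter> \<phi> z -` {0<..}" using z0 by (auto simp: A_def)
      then show ?thesis using continuous_openin_preimage_gen[OF contz' open_greaterThan] by simp
    qed
    have opB: "openin (top_of_set (V - {z})) B"
    proof -
      have "B = (V - {z}) \<inter> \<phi> z -` {..<0}" using z0 by (auto simp: B_def)
      then show ?thesis using continuous_openin_preimage_gen[OF contz' open_lessThan] by simp
    qed
    have "(V - {z}) - A = B" "(V - {z}) - B = A" using nz[OF z] z0 by (force simp: A_def B_def)+
    moreover have "A \<subseteq> V - {z}" "B \<subseteq> V - {z}" using z0 by (auto simp: A_def B_def)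
    ultimately have clA: "closedin (top_of_set (V - {z})) A" and clB: "closedin (top_of_set (V - {z})) B"
      using opA opB by (auto simp: closedin_def)
    \<comment> \<open>Removing \<open>z\<close> may disconnect \<open>V\<close>, but a clopen piece
      of the rest becomes connected when \<open>z\<close> is put back.\<close>
    have cA: "connected (insert z A)" and cB: "connected (insert z B)"
      using connected_Un_clopen_in_complement[of "{z}" V A] connected_Un_clopen_in_complement[of "{z}" V B]
        opA opB clA clB V z by auto
    have aA: "a \<in> A" "a \<noteq> z" and bB: "b \<in> B" "b \<noteq> z" using c ab z0 by (auto simp: A_def B_def)
    \<comment> \<open>\<open>A\<close> and \<open>B\<close> are disjoint, so removing
      \<open>(z, z)\<close> clears the product of all diagonal points, where \<phi> vanishes
      trivially.\<close>
    define P where "P = insert z A \<times> insert z B - {(z, z)}"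
    have "connected P" unfolding P_def
      using aA bB by (intro connected_Times_minus_point[OF cA cB, of a z b z]) auto
    moreover have PV: "P \<subseteq> V \<times> V" using z by (auto simp: P_def A_def B_def)
    ultimately have "connected ((\<lambda>p. \<phi> (fst p) (snd p)) ` P)"
      using continuous_on_subset[OF cont] connected_continuous_image by blast
    moreover have "(z, b) \<in> P" "(a, z) \<in> P" using aA bB by (auto simp: P_def)
    then have "\<phi> z b \<in> (\<lambda>p. \<phi> (fst p) (snd p)) ` P" "\<phi> z a \<in> (\<lambda>p. \<phi> (fst p) (snd p)) ` P"
      by (force simp: sym[of z a])+
    ultimately have "0 \<in> (\<lambda>p. \<phi> (fst p) (snd p)) ` P"
      using c connectedD_interval[of _ "\<phi> z b" "\<phi> z a" 0] by (simp add: less_imp_le)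
    then obtain u v where uv: "(u, v) \<in> P" "\<phi> u v = 0" by auto
    moreover have "u \<noteq> v" using uv(1) z0 by (auto simp: P_def A_def B_def)
    ultimately show False using nz PV by blast
  qed
  show ?thesis
  proof (rule ccontr)
    assume "\<not> ?thesis"
    then obtain z w z' w' where *: "z \<in> V" "w \<in> V" "z \<noteq> w" "\<not> \<phi> z w > 0"
      "z' \<in> V" "w' \<in> V" "z' \<noteq> w'" "\<not> \<phi> z' w' < 0"
      unfolding \<phi>_def by auto
    then have n: "\<phi> z w < 0" "\<phi> z' w' > 0" using nz[of z w] nz[of z' w'] by auto
    show False
    proof (cases "z = z'")
      case True
      then show ?thesis using one[of z w' w] n * by simp
    next
      case False
      \<comment> \<open>The sign of the connecting pair clashes with that of the given pair at
        \<open>z\<close> or at \<open>z'\<close>.\<close>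
      then have "\<phi> z z' \<noteq> 0" using nz * by blast
      then show ?thesis using one[of z z' w] one[of z' w' z] n * sym[of z z'] by linarith
    qed
  qed
qed

section \<open>From balanced pairs to retracts\<close>

lemma complex_differentiable_nth_compose:
  assumes "\<phi> field_differentiable at (z $ i)"
  shows "complex_differentiable (\<lambda>z. \<phi> (z $ i)) z"
  using complex_differentiable_compose[OF complex_differentiable_nth assms] .

lemma graph_holomorphic_retract:
  fixes V :: "(complex ^ 2) set"
  assumes ik: "i \<noteq> k"
    and f: "\<And>\<zeta>. norm \<zeta> < 1 \<Longrightarrow> f field_differentiable at \<zeta>" "\<And>\<zeta>. norm \<zeta> < 1 \<Longrightarrow> norm (f \<zeta>) < 1"
    and V: "V = (\<lambda>\<zeta>. pt i \<zeta> (f \<zeta>)) ` ball 0 1"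
  shows "holomorphic_retract polydisc V"
  unfolding holomorphic_retract_def
proof (intro exI conjI ballI)
  define r where "r z = pt i (z $ i) (f (z $ i))" for z :: "complex ^ 2"
  show "holomorphic_map polydisc r"
    unfolding holomorphic_map_def holomorphic_Cn_iff
  proof (intro allI ballI)
    fix j and z :: "complex ^ 2"
    assume "z \<in> polydisc"
    then have "f field_differentiable at (z $ i)" using f(1) polydisc_nth by blast
    then show "complex_differentiable (\<lambda>z. r z $ j) z"
      using type2_cases[OF ik, of j] ik
      by (auto simp: r_def intro: complex_differentiable_nth complex_differentiable_nth_compose)
  qed
  show rD: "r ` polydisc \<subseteq> polydisc"
    using f(2) polydisc_nth by (auto simp: r_def intro!: pt_in_polydisc)
  show rV: "r z = z" if "z \<in> V" for z using that by (auto simp: V r_def)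
  have "r z \<in> V" if "z \<in> polydisc" for z using polydisc_nth[OF that] by (auto simp: V r_def)
  moreover have "V \<subseteq> polydisc" using f(2) by (auto simp: V intro!: pt_in_polydisc)
  ultimately show "r ` polydisc = V" using rV by force
qed

lemma polydisc_holomorphic_retract: "holomorphic_retract polydisc polydisc"
  unfolding holomorphic_retract_def
  by (intro exI[of _ "\<lambda>z. z"]) (auto simp: holomorphic_map_def holomorphic_Cn_iff complex_differentiable_nth)

lemma singleton_holomorphic_retract:
  assumes "v \<in> polydisc"
  shows "holomorphic_retract polydisc {v}"
  unfolding holomorphic_retract_def using assms
  by (intro exI[of _ "\<lambda>z. v"]) (auto simp: holomorphic_map_def holomorphic_Cn_iff complex_differentiable_const)

lemma infinite_unimodular_near_1:
  assumes "0 \<le> b" "b < 1"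
  shows "infinite {k :: complex. norm k = 1 \<and> Re k > b}"
proof -
  define v0 where "v0 = sqrt (1 - b\<^sup>2)"
  have b2: "b\<^sup>2 < 1" using assms by (simp add: abs_square_less_1)
  then have v0: "v0 > 0" by (simp add: v0_def)
  have "{0<..<v0} \<subseteq> Im ` {k. norm k = 1 \<and> Re k > b}"
  proof
    fix v assume "v \<in> {0<..<v0}"
    then have v: "0 < v" "v < v0" by auto
    then have "v\<^sup>2 < v0\<^sup>2" by (intro power_strict_mono) auto
    then have v2: "v\<^sup>2 < 1 - b\<^sup>2" using b2 by (simp add: v0_def)
    then have "b < sqrt (1 - v\<^sup>2)" by (intro real_less_rsqrt) simp
    moreover have "v\<^sup>2 \<le> 1" using v2 zero_le_power2[of b] by linarith
    then have "norm (Complex (sqrt (1 - v\<^sup>2)) v) = 1" by (simp add: complex_norm)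
    ultimately show "v \<in> Im ` {k. norm k = 1 \<and> Re k > b}"
      by (intro image_eqI[of _ _ "Complex (sqrt (1 - v\<^sup>2)) v"]) auto
  qed
  then show ?thesis using infinite_Ioo[OF v0] finite_subset by blast
qed

text \<open>At \<open>l = 0\<close> the disc with coordinates \<open>mob (- a) l\<close> and
  \<open>mob (- b) (c * l)\<close> passes through \<open>(a, b)\<close>, and its slope there is the
  quotient of the two derivatives. The error \<open>e\<close> matches the hypothesis on limit
  slopes.\<close>

lemma disc_tangent_slope:
  assumes a: "norm a < 1" and b: "norm b < 1" and c: "norm c = 1" and e: "e > 0"
  obtains l where "norm l < 1" "mob (- a) l - a \<noteq> 0" "norm (mob (- a) l - a) < e"
    "norm ((mob (- b) (c * l) - b) / (mob (- a) l - a) - c * (1 - b * cnj b) / (1 - a * cnj a)) < e"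
proof -
  have na: "1 - a * cnj a \<noteq> 0" using one_minus_norm_sq_nonzero a by blast
  have diff: "mob (- x) l - x = l * (1 - x * cnj x) / (1 + cnj x * l)" if "norm x < 1" "norm l \<le> 1" for x l
  proof -
    have "1 + cnj x * l \<noteq> 0" using mob_denom_nonzero[of "- x" l] that by simp
    then show ?thesis by (simp add: mob_def field_simps)
  qed
  define \<psi> where "\<psi> l = c * (1 - b * cnj b) / (1 - a * cnj a) * ((1 + cnj a * l) / (1 + cnj b * (c * l)))" for l
  have quot: "(mob (- b) (c * l) - b) / (mob (- a) l - a) = \<psi> l" if "norm l < 1" "l \<noteq> 0" for l
  proof -
    have "1 + cnj a * l \<noteq> 0" using mob_denom_nonzero[of "- a" l] that a by simp
    then show ?thesis
      using that c na by (simp add: diff a b norm_mult \<psi>_def divide_simps)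
  qed
  have 1: "(\<psi> \<longlongrightarrow> c * (1 - b * cnj b) / (1 - a * cnj a) * ((1 + cnj a * 0) / (1 + cnj b * (c * 0)))) (at 0)"
    unfolding \<psi>_def by (intro tendsto_intros) auto
  have 2: "((\<lambda>l. l * (1 - a * cnj a) / (1 + cnj a * l)) \<longlongrightarrow> 0 * (1 - a * cnj a) / (1 + cnj a * 0)) (at 0)"
    by (intro tendsto_intros) auto
  have "\<forall>\<^sub>F l in at 0. dist (\<psi> l) (c * (1 - b * cnj b) / (1 - a * cnj a)) < e"
    using tendstoD[OF 1 e] by simp
  moreover have "\<forall>\<^sub>F l in at 0. dist (l * (1 - a * cnj a) / (1 + cnj a * l)) 0 < e"
    using tendstoD[OF 2 e] by simp
  moreover have "\<forall>\<^sub>F l :: complex in at 0. norm l < 1"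
    using eventually_at_ball[of 1 "0 :: complex" UNIV] by (simp add: dist_norm)
  moreover have "\<forall>\<^sub>F l :: complex in at 0. l \<noteq> 0" by (simp add: eventually_neq_at_within)
  ultimately have "\<forall>\<^sub>F l in at 0. dist (\<psi> l) (c * (1 - b * cnj b) / (1 - a * cnj a)) < e \<and>
      dist (l * (1 - a * cnj a) / (1 + cnj a * l)) 0 < e \<and> norm l < 1 \<and> l \<noteq> 0"
    by eventually_elim blast
  then obtain l where l: "dist (\<psi> l) (c * (1 - b * cnj b) / (1 - a * cnj a)) < e"
      "dist (l * (1 - a * cnj a) / (1 + cnj a * l)) 0 < e" "norm l < 1" "l \<noteq> 0"
    using eventually_happens' [OF at_neq_bot] by blast
  show thesis
  proof (rule that[OF l(3)])
    have "1 + cnj a * l \<noteq> 0" using mob_denom_nonzero[of "- a" l] l a by simp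
    then show "mob (- a) l - a \<noteq> 0" using diff[OF a, of l] l na by simp
    show "norm (mob (- a) l - a) < e" using diff[OF a, of l] l(2,3) by simp
    show "norm ((mob (- b) (c * l) - b) / (mob (- a) l - a) - c * (1 - b * cnj b) / (1 - a * cnj a)) < e"
      using l(1) quot[OF l(3,4)] by (simp add: dist_norm)
  qed
qed

text \<open>A point \<open>x \<in> V\<close> off the disc through the balanced pair is balanced with infinitely many points of that
  disc (those over the hyperbolic bisector), which puts infinitely many discs through \<open>x\<close> into \<open>V\<close>.\<close>
lemma balanced_pair_holomorphic_retract:
  fixes V :: "(complex ^ 2) set"
  assumes V: "analytic_subvariety polydisc V" and PC: "polynomially_convex_in polydisc V"
    and C: "caratheodory_set polydisc V" and ik: "i \<noteq> k"
    and zw: "z \<in> V" "w \<in> V" "z \<noteq> w"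
    and bal: "norm (mob (z $ i) (w $ i)) = norm (mob (z $ k) (w $ k))"
  shows "holomorphic_retract polydisc V"
proof -
  have "closedin (top_of_set polydisc) V" using V by (simp add: analytic_subvariety_def)
  then have VD: "V \<subseteq> polydisc" by (rule closedin_imp_subset)
  have V1: "norm (v $ j) < 1" if "v \<in> V" for v j using that VD polydisc_nth by auto
  have disc: "\<exists>c. norm c = 1 \<and> mob (p $ k) (q $ k) = c * mob (p $ i) (q $ i) \<and>
      (\<forall>l. norm l < 1 \<longrightarrow> pt i (mob (- (p $ i)) l) (mob (- (p $ k)) (c * l)) \<in> V)"
    if pq: "p \<in> V" "q \<in> V" "p \<noteq> q" "norm (mob (p $ i) (q $ i)) = norm (mob (p $ k) (q $ k))" for p q
  proof -
    have nz: "mob (p $ i) (q $ i) \<noteq> 0"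
    proof
      assume "mob (p $ i) (q $ i) = 0"
      then have "q $ i = p $ i" "q $ k = p $ k"
        using pq V1 mob_eq_0_iff by (auto simp: less_imp_le)
      then show False using pq(3) pt_nth_nth[OF ik] by metis
    qed
    define c where "c = mob (p $ k) (q $ k) / mob (p $ i) (q $ i)"
    have "norm c = 1" unfolding c_def norm_divide pq(4)[symmetric] using nz by simp
    moreover have "mob (p $ k) (q $ k) = c * mob (p $ i) (q $ i)" using nz by (simp add: c_def)
    ultimately show ?thesis using balanced_pair_disc[OF C VD PC ik pq(1-3)] by blast
  qed
  obtain c where c: "norm c = 1" "\<And>l. norm l < 1 \<Longrightarrow> pt i (mob (- (z $ i)) l) (mob (- (z $ k)) (c * l)) \<in> V"
    using disc[OF zw bal] by blast
  \<comment> \<open>The disc as a graph over coordinate \<open>i\<close>, obtained by solving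
    \<open>\<zeta> = mob (- (z $ i)) l\<close> for \<open>l\<close>.\<close>
  define f where "f \<zeta> = mob (- (z $ k)) (c * mob (z $ i) \<zeta>)" for \<zeta>
  have f1: "norm (f \<zeta>) < 1" if "norm \<zeta> < 1" for \<zeta>
    unfolding f_def using c(1) V1[OF zw(1)] that norm_mob_less_1 by (auto simp: norm_mult intro!: norm_mob_less_1)
  have fV: "pt i \<zeta> (f \<zeta>) \<in> V" if "norm \<zeta> < 1" for \<zeta>
    using c(2)[of "mob (z $ i) \<zeta>"] norm_mob_less_1[OF V1[OF zw(1)] that] mob_minus_mob[OF V1[OF zw(1)]] that
    by (simp add: f_def less_imp_le)
  \<comment> \<open>Hence any two points of this graph are balanced, which allows recentring at an
    arbitrary point of it.\<close>
  have fdist: "norm (mob (f \<zeta>) (f \<xi>)) = norm (mob \<zeta> \<xi>)" if "norm \<zeta> < 1" "norm \<xi> < 1" for \<zeta> \<xi>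
  proof -
    have n: "norm (mob (z $ i) \<zeta>) < 1" "norm (mob (z $ i) \<xi>) < 1"
      using that V1[OF zw(1)] norm_mob_less_1 by auto
    have "norm (mob (f \<zeta>) (f \<xi>)) = norm (mob (c * mob (z $ i) \<zeta>) (c * mob (z $ i) \<xi>))"
      unfolding f_def using n c(1) V1[OF zw(1)] by (intro norm_mob_mob_mob) (auto simp: norm_mult)
    also have "\<dots> = norm (mob (mob (z $ i) \<zeta>) (mob (z $ i) \<xi>))"
      using c(1) by (simp add: mob_rotate norm_mult)
    also have "\<dots> = norm (mob \<zeta> \<xi>)" using that V1[OF zw(1)] by (intro norm_mob_mob_mob)
    finally show ?thesis .
  qed
  show ?thesis
  proof (cases "V \<subseteq> (\<lambda>\<zeta>. pt i \<zeta> (f \<zeta>)) ` ball 0 1")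
    case True
    then have "V = (\<lambda>\<zeta>. pt i \<zeta> (f \<zeta>)) ` ball 0 1" using fV by auto
    moreover have "f field_differentiable at \<zeta>" if "norm \<zeta> < 1" for \<zeta>
    proof -
      have 1: "mob (z $ i) field_differentiable at \<zeta>"
        using V1[OF zw(1)] that by (intro mob_field_differentiable) auto
      have "norm (c * mob (z $ i) \<zeta>) \<le> 1"
        using norm_mob_less_1[OF V1[OF zw(1)] that, of i] c(1) by (simp add: norm_mult)
      then have 2: "mob (- (z $ k)) field_differentiable at (c * mob (z $ i) \<zeta>)"
        using V1[OF zw(1)] by (intro mob_field_differentiable) auto
      have 3: "(\<lambda>\<zeta>. c * mob (z $ i) \<zeta>) field_differentiable at \<zeta>"
        using 1 by (intro field_differentiable_mult field_differentiable_const)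
      show ?thesis using field_differentiable_compose[OF 3 2] by (simp add: f_def[abs_def] o_def)
    qed
    ultimately show ?thesis using graph_holomorphic_retract[OF ik, of f V] f1 by blast
  next
    case False
    then obtain x where x: "x \<in> V" "x \<notin> (\<lambda>\<zeta>. pt i \<zeta> (f \<zeta>)) ` ball 0 1" by blast
    define a b y where "a = x $ i" "b = x $ k" "y = f a"
    note aby = this
    have a1: "norm a < 1" and b1: "norm b < 1" using x(1) V1 by (auto simp: aby)
    have y1: "norm y < 1" unfolding aby(3) by (rule f1[OF a1])
    have yb: "y \<noteq> b"
    proof
      assume "y = b"
      then have "x = pt i a (f a)" using pt_nth_nth[OF ik, of x] by (simp add: aby)
      then show False using x(2) a1 by auto
    qed
    \<comment> \<open>\<open>p0\<close> is the graph point over \<open>x $ i\<close>. A disc centred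
      there has \<open>i\<close>-coordinate \<open>mob (- a) l\<close>, at pseudohyperbolic distance
      \<open>norm l\<close> from \<open>x $ i\<close>.\<close>
    define p0 where "p0 = pt i a y"
    define \<xi> :: complex where "\<xi> = (if a = 0 then 1/2 else 0)"
    have \<xi>: "norm \<xi> < 1" "\<xi> \<noteq> a" by (auto simp: \<xi>_def)
    define q where "q = pt i \<xi> (f \<xi>)"
    have p0V: "p0 \<in> V" and qV: "q \<in> V" using fV a1 \<xi> by (auto simp: p0_def q_def aby(3))
    have comp: "p0 $ i = a" "p0 $ k = y" "q $ i = \<xi>" "q $ k = f \<xi>" using ik by (auto simp: p0_def q_def)
    have "p0 \<noteq> q" using comp \<xi> by auto
    moreover have "norm (mob (p0 $ i) (q $ i)) = norm (mob (p0 $ k) (q $ k))"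
      unfolding comp aby(3) using fdist[OF a1 \<xi>(1)] by simp
    ultimately obtain c' where c': "norm c' = 1"
      "\<And>l. norm l < 1 \<Longrightarrow> pt i (mob (- a) l) (mob (- y) (c' * l)) \<in> V"
      using disc[OF p0V qV] comp by metis
    have cc': "c' * cnj c' = 1" using c'(1) by (simp add: complex_norm_square[symmetric])
    \<comment> \<open>The pair of \<open>x\<close> and the disc point at parameter \<open>m\<close>
      has coordinate distances \<open>norm m\<close> and \<open>norm (mob B m)\<close>, so it is
      balanced exactly on the bisector of 0 and \<open>B\<close>.\<close>
    define B where "B = cnj c' * mob y b"
    have Bm: "mob y b = c' * B" using cc' by (simp add: B_def flip: mult.assoc)
    have B0: "B \<noteq> 0" using mob_eq_0_iff[of y b] y1 b1 yb cc' by (auto simp: B_def)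
    have B1: "norm B < 1" using norm_mob_less_1[OF y1 b1] c'(1) by (simp add: B_def norm_mult)
    define g where "g = (1 - b * cnj y) / (1 - cnj b * y)"
    have g1: "norm g = 1" unfolding g_def by (rule norm_mob_factor[OF b1 y1])
    define K where "K = {\<kappa>. norm \<kappa> = 1 \<and> Re \<kappa> > norm B}"
    \<comment> \<open>The rotation constant of the balanced pair: \<open>g\<close> comes from
      changing the centre \<open>y\<close> to \<open>b\<close>, \<open>c'\<close> from the disc, the
      last factor from \<open>bisector_point\<close>.\<close>
    define Cf where "Cf \<kappa> = g * c' * (- (cnj \<kappa>)\<^sup>2)" for \<kappa>
    have Cf1: "norm (Cf \<kappa>) = 1" if "\<kappa> \<in> K" for \<kappa>
      using that g1 c'(1) by (simp add: Cf_def K_def norm_mult norm_power)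
    have discs: "pt i (mob (- a) l) (mob (- b) (Cf \<kappa> * l)) \<in> V" if \<kappa>: "\<kappa> \<in> K" and l: "norm l < 1" for \<kappa> l
    proof -
      obtain m where m: "norm m < 1" "m \<noteq> 0" "mob B m = - (cnj \<kappa>)\<^sup>2 * m"
        using bisector_point[OF B0 B1] \<kappa> unfolding K_def by blast
      define p where "p = pt i (mob (- a) m) (mob (- y) (c' * m))"
      have pV: "p \<in> V" unfolding p_def by (rule c'(2)[OF m(1)])
      have pc: "p $ i = mob (- a) m" "p $ k = mob (- y) (c' * m)" using ik by (auto simp: p_def)
      have i: "mob (x $ i) (p $ i) = m"
        unfolding pc aby(1)[symmetric] using mob_mob_minus[OF a1] m(1) by simp
      have "mob (x $ k) (p $ k) = g * mob (mob y b) (c' * m)"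
        unfolding pc aby(2)[symmetric] g_def using m(1) c'(1)
        by (intro mob_mob_minus_eq[OF b1 y1]) (simp add: norm_mult)
      also have "\<dots> = Cf \<kappa> * m" unfolding Bm mob_rotate[OF c'(1)] m(3) by (simp add: Cf_def)
      finally have k: "mob (x $ k) (p $ k) = Cf \<kappa> * mob (x $ i) (p $ i)" unfolding i .
      have "x \<noteq> p" using i m(2) by auto
      from balanced_pair_disc[OF C VD PC ik x(1) pV this Cf1[OF \<kappa>] k l]
      show ?thesis by (simp add: aby)
    qed
    define \<sigma> where "\<sigma> \<kappa> = Cf \<kappa> * (1 - b * cnj b) / (1 - a * cnj a)" for \<kappa>
    have "inj_on \<sigma> K"
    proof (rule inj_onI)
      fix \<kappa> \<mu> assume K: "\<kappa> \<in> K" "\<mu> \<in> K" and eq: "\<sigma> \<kappa> = \<sigma> \<mu>"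
      have "g \<noteq> 0" "c' \<noteq> 0" using g1 c'(1) by auto
      then have "(cnj \<kappa>)\<^sup>2 = (cnj \<mu>)\<^sup>2"
        using eq one_minus_norm_sq_nonzero[OF a1] one_minus_norm_sq_nonzero[OF b1] by (simp add: \<sigma>_def Cf_def)
      then have "cnj \<kappa> = cnj \<mu> \<or> cnj \<kappa> = - cnj \<mu>" by (simp add: power2_eq_iff)
      then have "\<kappa> = \<mu> \<or> \<kappa> = - \<mu>" by (metis complex_cnj_cancel_iff complex_cnj_minus)
      \<comment> \<open>The slope determines \<kappa> only up to sign; positive real parts rule out
        \<open>- \<mu>\<close>.\<close>
      moreover have "Re \<kappa> > 0" "Re \<mu> > 0" using K norm_ge_zero[of B] unfolding K_def mem_Collect_eq by linarith+
      ultimately show "\<kappa> = \<mu>" by auto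
    qed
    moreover have "infinite K" unfolding K_def using B1 by (intro infinite_unimodular_near_1) auto
    ultimately have inf: "infinite (\<sigma> ` K)" by (simp add: finite_image_iff)
    have bd: "bounded (\<sigma> ` K)"
    proof -
      have "norm (\<sigma> \<kappa>) \<le> norm ((1 - b * cnj b) / (1 - a * cnj a))" if "\<kappa> \<in> K" for \<kappa>
        using Cf1[OF that] by (simp add: \<sigma>_def norm_mult norm_divide)
      then show ?thesis unfolding bounded_iff by blast
    qed
    have "x \<in> interior V"
    proof (rule infinitely_many_tangent_slopes_interior[OF V x(1) ik inf bd])
      fix s and e :: real assume s: "s \<in> \<sigma> ` K" and e: "e > 0"
      then obtain \<kappa> where \<kappa>: "\<kappa> \<in> K" "s = \<sigma> \<kappa>" by blast
      obtain l where l: "norm l < 1" "mob (- a) l - a \<noteq> 0" "norm (mob (- a) l - a) < e"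
        "norm ((mob (- b) (Cf \<kappa> * l) - b) / (mob (- a) l - a) - Cf \<kappa> * (1 - b * cnj b) / (1 - a * cnj a)) < e"
        using disc_tangent_slope[OF a1 b1 Cf1[OF \<kappa>(1)] e] by blast
      define h where "h = mob (- a) l - a"
      define s' where "s' = (mob (- b) (Cf \<kappa> * l) - b) / h"
      have "x $ i + h = mob (- a) l" by (simp add: h_def aby)
      moreover have "x $ k + h * s' = mob (- b) (Cf \<kappa> * l)"
        using l(2) by (simp add: s'_def h_def[symmetric]) (simp add: aby)
      ultimately have "pt i (mob (- a) l) (mob (- b) (Cf \<kappa> * l)) = x + h *s pt i 1 s'"
        using ik by (intro pt_eqI[OF ik]) simp_all
      then have "x + h *s pt i 1 s' \<in> V" using discs[OF \<kappa>(1) l(1)] by simp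
      then show "\<exists>h s'. 0 < norm h \<and> norm h < e \<and> norm (s' - s) < e \<and> x + h *s pt i 1 s' \<in> V"
        using l \<kappa>(2) by (intro exI[of _ h] exI[of _ s']) (simp add: h_def s'_def \<sigma>_def)
    qed
    then have "V = polydisc"
      using analytic_subvariety_interior[OF V open_polydisc convex_connected[OF convex_polydisc]] by blast
    then show ?thesis using polydisc_holomorphic_retract by simp
  qed
qed

section \<open>Graphs over a coordinate disc\<close>

text \<open>If the projection misses a point of the disc, it misses some \<open>b\<close> whose nearest point in the
  projection is attained at some \<open>e\<close>.  Then \<open>v \<mapsto> \<bar>e - b\<bar> / (v $ i - b)\<close> peaks at the point of \<open>V\<close> over \<open>e\<close>,
  so it separates that point from the rest of \<open>V\<close> by infinite Poincare distance.\<close>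
lemma dominant_projection_onto_disc:
  fixes V :: "(complex ^ 2) set"
  assumes clV: "closedin (top_of_set polydisc) V" and C: "caratheodory_set polydisc V" and ik: "i \<noteq> k"
    and dom: "\<And>z w. z \<in> V \<Longrightarrow> w \<in> V \<Longrightarrow> z \<noteq> w \<Longrightarrow>
        norm (mob (z $ k) (w $ k)) < norm (mob (z $ i) (w $ i))"
    and two: "v0 \<in> V" "v1 \<in> V" "v0 \<noteq> v1"
  shows "(\<lambda>v. v $ i) ` V = ball 0 1"
proof -
  have VD: "V \<subseteq> polydisc" using clV by (rule closedin_imp_subset)
  have V1: "norm (v $ j) < 1" if "v \<in> V" for v j using that VD polydisc_nth by auto
  define Kc where "Kc = (\<lambda>v. v $ i) ` closure V"
  have "compact Kc" unfolding Kc_def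
    by (intro compact_continuous_image compact_closure_subset_polydisc VD continuous_intros)
  then have clK: "closed Kc" by (rule compact_imp_closed)
  have sub: "(\<lambda>v. v $ i) ` V \<subseteq> Kc" using closure_subset by (auto simp: Kc_def)
  \<comment> \<open>Dominance passes to limits: while coordinate \<open>i\<close> stays inside the
    disc, coordinate \<open>k\<close> cannot reach the unit circle. So the limit lies in the
    polydisc, hence in \<open>V\<close>.\<close>
  have KV: "\<exists>v\<in>V. v $ i = \<zeta>" if \<zeta>: "\<zeta> \<in> Kc" "norm \<zeta> < 1" for \<zeta>
  proof -
    obtain v where v: "v \<in> closure V" "v $ i = \<zeta>" using \<zeta>(1) by (auto simp: Kc_def)
    obtain s where s: "\<And>n. s n \<in> V" "s \<longlonglongrightarrow> v" using v(1) closure_sequential by blast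
    have n1: "norm (v $ j) \<le> 1" for j by (rule closure_polydisc_nth[OF VD v(1)])
    have lim: "(\<lambda>n. norm (mob (v0 $ j) (s n $ j))) \<longlonglongrightarrow> norm (mob (v0 $ j) (v $ j))" for j
      using s(2) n1 V1[OF two(1)]
      by (intro tendsto_norm isCont_tendsto_compose[OF isCont_mob] tendsto_vec_nth)
    have "norm (mob (v0 $ k) (s n $ k)) \<le> norm (mob (v0 $ i) (s n $ i))" for n
      using dom[OF two(1) s(1)[of n]] by (cases "v0 = s n") auto
    then have "norm (mob (v0 $ k) (v $ k)) \<le> norm (mob (v0 $ i) (v $ i))"
      by (intro LIMSEQ_le[OF lim lim]) auto
    also have "\<dots> < 1" using v(2) \<zeta>(2) V1[OF two(1)] norm_mob_less_1 by auto
    finally have "norm (v $ k) \<noteq> 1" using norm_mob_eq_1[of "v0 $ k" "v $ k"] V1[OF two(1)] by auto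
    then have "norm (v $ j) < 1" for j
      using type2_cases[OF ik, of j] n1[of k] v(2) \<zeta>(2) by auto
    then have "v \<in> polydisc" by (simp add: polydisc_def)
    moreover obtain T where T: "closed T" "V = polydisc \<inter> T" using clV closedin_closed by metis
    then have "closure V \<subseteq> T" by (intro closure_minimal) auto
    ultimately have "v \<in> V" using T v(1) by auto
    then show ?thesis using v(2) by blast
  qed
  have "ball 0 1 \<subseteq> Kc"
  proof (rule ccontr)
    assume nsub: "\<not> ball 0 1 \<subseteq> Kc"
    have "\<exists>e0\<in>Kc \<inter> ball 0 1. \<forall>\<epsilon>>0. \<exists>b. dist b e0 < \<epsilon> \<and> b \<notin> Kc"
    proof (rule ccontr)
      assume "\<not> ?thesis"
      then have "\<forall>e0\<in>Kc \<inter> ball 0 1. \<exists>\<epsilon>>0. ball e0 \<epsilon> \<subseteq> Kc"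
        by (force simp: dist_commute)
      then have int: "Kc \<inter> ball 0 1 \<subseteq> interior Kc" by (auto simp: mem_interior)
      have "interior Kc \<inter> ball 0 1 = {} \<or> - Kc \<inter> ball (0 :: complex) 1 = {}"
      proof (rule connectedD)
        show "connected (ball (0 :: complex) 1)" by simp
        show "open (interior Kc)" "open (- Kc)" using clK by auto
        show "interior Kc \<inter> - Kc \<inter> ball 0 1 = {}" using interior_subset by blast
        show "ball 0 1 \<subseteq> interior Kc \<union> - Kc" using int by blast
      qed
      moreover have "v0 $ i \<in> Kc \<inter> ball 0 1" using sub V1[OF two(1)] two(1) by auto
      ultimately show False using nsub int by blast
    qed
    then obtain e0 where e0: "e0 \<in> Kc" "norm e0 < 1" "\<And>\<epsilon>. \<epsilon> > 0 \<Longrightarrow> \<exists>b. dist b e0 < \<epsilon> \<and> b \<notin> Kc" by auto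
    \<comment> \<open>\<open>b\<close> is within a third of the gap from \<open>e0\<close>, and its
      nearest point \<open>e\<close> is no farther from \<open>b\<close>, so \<open>e\<close> stays
      in the open disc.\<close>
    have "(1 - norm e0) / 3 > 0" using e0 by simp
    then obtain b where b: "dist b e0 < (1 - norm e0) / 3" "b \<notin> Kc" using e0(3) by blast
    have "Kc \<noteq> {}" using e0 by auto
    then obtain e where e: "e \<in> Kc" "\<And>y. y \<in> Kc \<Longrightarrow> dist b e \<le> dist b y"
      using distance_attains_inf[OF clK] by metis
    define d where "d = dist b e"
    have d: "d > 0" using e(1) b(2) by (auto simp: d_def)
    have "d \<le> dist b e0" using e(2)[OF e0(1)] by (simp add: d_def)
    have "norm e \<le> norm e0 + dist b e0 + dist b e"
      using norm_triangle_ineq[of e0 "(b - e0) + (e - b)"] norm_triangle_ineq[of "b - e0" "e - b"]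
      by (simp add: dist_norm norm_minus_commute)
    then have "norm e < 1" using \<open>d \<le> dist b e0\<close> b(1) e0(2) by (simp add: d_def)
    then obtain u where u: "u \<in> V" "u $ i = e" using KV[OF e(1)] by blast
    obtain w where w: "w \<in> V" "w \<noteq> u" using two by metis
    have far: "norm (v $ i - b) \<ge> d" if "v \<in> V" for v
      using e(2)[of "v $ i"] sub that by (auto simp: d_def dist_norm norm_minus_commute)
    define F where "F v = of_real d / (v $ i - b)" for v :: "complex ^ 2"
    have F1: "norm (F v) \<le> 1" if "v \<in> V" for v
      using far[OF that] d by (simp add: F_def norm_divide divide_le_eq)
    have Fu: "norm (F u) = 1" using d by (simp add: F_def norm_divide u(2) d_def dist_norm norm_minus_commute)
    have "w $ i \<noteq> u $ i"
      using dom[OF w(1) u(1) w(2)] norm_ge_zero[of "mob (w $ k) (u $ k)"] by (auto simp del: norm_ge_zero)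
    then have Fwu: "F w \<noteq> F u" using d far[OF w(1)] far[OF u(1)] by (auto simp: F_def divide_simps)
    define \<tau> where "\<tau> = norm (mob (w $ i) (u $ i))"
    have \<tau>: "\<tau> < 1" "norm (mob (w $ j) (u $ j)) \<le> \<tau>" for j
      using norm_mob_less_1 V1 u(1) w(1) dom[OF w(1) u(1) w(2)] type2_cases[OF ik, of j]
      by (auto simp: \<tau>_def)
    \<comment> \<open>\<open>F\<close> has modulus 1 at \<open>u\<close>, so it is scaled by
      \<open>r < 1\<close> to map into the open disc; the bound \<tau> is uniform in
      \<open>r\<close>.\<close>
    have le: "norm (mob (of_real r * F w) (of_real r * F u)) \<le> \<tau>" if r: "0 < r" "r < 1" for r
    proof -
      define W where "W = polydisc \<inter> {v :: complex ^ 2. v $ i \<noteq> b}"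
      have "open W" unfolding W_def
        by (intro open_Int open_polydisc open_Collect_neq continuous_intros)
      moreover have "holomorphic_Cn W (\<lambda>v. of_real r * F v)"
        unfolding holomorphic_Cn_iff
      proof
        fix v assume "v \<in> W"
        then have "(\<lambda>x. of_real d / (x - b)) field_differentiable at (v $ i)"
          by (intro derivative_intros) (auto simp: W_def)
        then show "complex_differentiable (\<lambda>v. of_real r * F v) v"
          unfolding F_def by (intro complex_differentiable_cmult complex_differentiable_nth_compose)
      qed
      moreover have "V \<subseteq> W" using VD far d by (force simp: W_def)
      ultimately have "holomorphic_on_subset polydisc V (\<lambda>v. of_real r * F v)"
        by (intro holomorphic_on_subsetI[of W]) (auto simp: W_def)
      moreover have "norm (of_real r * F v) < 1" if "v \<in> V" for v
      proof -
        have "r * norm (F v) \<le> r * 1" using F1[OF that] r by (intro mult_left_mono) auto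
        moreover have "norm (of_real r * F v) = r * norm (F v)" using r by (simp add: norm_mult)
        ultimately show ?thesis using r(2) by linarith
      qed
      ultimately have "(\<lambda>v. of_real r * F v) \<in> disc_functions polydisc V"
        by (auto simp: disc_functions_def)
      from caratheodory_set_contract[OF C VD u(1) w(1) this \<tau>] show ?thesis .
    qed
    have "((\<lambda>r. norm (mob (of_real r * F u) (of_real r * F w))) \<longlongrightarrow> 1) (at_left 1)"
      by (rule norm_mob_scaled_tendsto_1[OF Fu Fwu])
    moreover have "\<forall>\<^sub>F r in at_left (1 :: real). norm (mob (of_real r * F u) (of_real r * F w)) \<le> \<tau>"
    proof (rule eventually_mono[OF eventually_at_left_real[OF zero_less_one]])
      fix r :: real assume "r \<in> {0<..<1}"
      then show "norm (mob (of_real r * F u) (of_real r * F w)) \<le> \<tau>"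
        using le[of r] norm_mob_commute[of "of_real r * F u"] by simp
    qed
    ultimately have "1 \<le> \<tau>" by (intro tendsto_upperbound) auto
    then show False using \<tau>(1) by simp
  qed
  then show ?thesis using KV V1 by force
qed

text \<open>The denominators are at most 2 on the left and at least \<open>1 - norm a\<close> on the
  right. The constant does not involve \<open>b\<close>, so it bounds all difference quotients at
  \<open>a\<close>.\<close>

lemma norm_diff_le_of_mob_le:
  assumes "norm a < 1" "norm b < 1" "norm x < 1" "norm y < 1"
    and "norm (mob x y) \<le> norm (mob a b)"
  shows "norm (y - x) \<le> 2 / (1 - norm a) * norm (b - a)"
proof -
  have "norm (1 - cnj x * y) \<le> 1 + norm x * norm y"
    by (metis complex_mod_cnj norm_mult norm_one norm_triangle_ineq4)
  also have "norm x * norm y \<le> 1" using assms by (simp add: mult_le_one)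
  finally have le2: "norm (1 - cnj x * y) \<le> 2" by simp
  have nz: "1 - cnj x * y \<noteq> 0" using mob_denom_nonzero assms by auto
  have "norm a * norm b \<le> norm a" using assms by (simp add: mult_left_le)
  moreover have "1 - norm a * norm b \<le> norm (1 - cnj a * b)"
    by (metis complex_mod_cnj norm_mult norm_one norm_triangle_ineq2)
  ultimately have ge: "1 - norm a \<le> norm (1 - cnj a * b)" by simp
  have "norm (y - x) = norm (mob x y) * norm (1 - cnj x * y)"
    using nz by (simp add: mob_def norm_divide)
  also have "\<dots> \<le> norm (mob a b) * 2" using assms(5) le2 by (intro mult_mono) auto
  also have "norm (mob a b) \<le> norm (b - a) / (1 - norm a)"
    unfolding mob_def norm_divide using ge assms by (intro divide_left_mono mult_pos_pos) auto
  finally show ?thesis by (simp add: mult_ac)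
qed

lemma dominant_projection_holomorphic_retract:
  fixes V :: "(complex ^ 2) set"
  assumes V: "analytic_subvariety polydisc V" and C: "caratheodory_set polydisc V" and ik: "i \<noteq> k"
    and dom: "\<And>z w. z \<in> V \<Longrightarrow> w \<in> V \<Longrightarrow> z \<noteq> w \<Longrightarrow>
        norm (mob (z $ k) (w $ k)) < norm (mob (z $ i) (w $ i))"
    and two: "v0 \<in> V" "v1 \<in> V" "v0 \<noteq> v1"
  shows "holomorphic_retract polydisc V"
proof -
  have clV: "closedin (top_of_set polydisc) V" using V by (simp add: analytic_subvariety_def)
  then have VD: "V \<subseteq> polydisc" by (rule closedin_imp_subset)
  have V1: "norm (v $ j) < 1" if "v \<in> V" for v j using that VD polydisc_nth by auto
  have onto: "(\<lambda>v. v $ i) ` V = ball 0 1"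
    by (rule dominant_projection_onto_disc[OF clV C ik dom two])
  have inj: "z = w" if "z \<in> V" "w \<in> V" "z $ i = w $ i" for z w
    using dom[OF that(1,2)] that(3) norm_ge_zero[of "mob (z $ k) (w $ k)"]
    by (cases "z = w") (auto simp del: norm_ge_zero)
  define f where "f \<zeta> = (SOME v. v \<in> V \<and> v $ i = \<zeta>) $ k" for \<zeta>
  have fV: "pt i \<zeta> (f \<zeta>) \<in> V" if "norm \<zeta> < 1" for \<zeta>
  proof -
    have "\<exists>v. v \<in> V \<and> v $ i = \<zeta>" using onto that by (metis imageE mem_ball_0)
    then have "(SOME v. v \<in> V \<and> v $ i = \<zeta>) \<in> V \<and> (SOME v. v \<in> V \<and> v $ i = \<zeta>) $ i = \<zeta>" by (rule someI_ex)
    then show ?thesis using pt_nth_nth[OF ik] unfolding f_def by metis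
  qed
  have Vf: "V = (\<lambda>\<zeta>. pt i \<zeta> (f \<zeta>)) ` ball 0 1"
  proof
    show "(\<lambda>\<zeta>. pt i \<zeta> (f \<zeta>)) ` ball 0 1 \<subseteq> V" using fV by auto
    show "V \<subseteq> (\<lambda>\<zeta>. pt i \<zeta> (f \<zeta>)) ` ball 0 1"
    proof
      fix v assume v: "v \<in> V"
      then have "pt i (v $ i) (f (v $ i)) = v" using inj[OF fV[OF V1[OF v]] v] by simp
      then show "v \<in> (\<lambda>\<zeta>. pt i \<zeta> (f \<zeta>)) ` ball 0 1" using V1[OF v] by (metis imageI mem_ball_0)
    qed
  qed
  have f1: "norm (f \<zeta>) < 1" if "norm \<zeta> < 1" for \<zeta> using V1[OF fV[OF that], of k] ik by simp
  have contract: "norm (mob (f \<zeta>) (f \<xi>)) \<le> norm (mob \<zeta> \<xi>)" if "norm \<zeta> < 1" "norm \<xi> < 1" for \<zeta> \<xi>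
  proof (cases "\<zeta> = \<xi>")
    case False
    then have "pt i \<zeta> (f \<zeta>) \<noteq> pt i \<xi> (f \<xi>)" by (metis pt_nth(1))
    then show ?thesis using dom[OF fV[OF that(1)] fV[OF that(2)]] ik by simp
  qed simp
  have lip: "norm (f \<xi> - f \<zeta>) \<le> 2 / (1 - norm \<zeta>) * norm (\<xi> - \<zeta>)"
    if "norm \<zeta> < 1" "norm \<xi> < 1" for \<zeta> \<xi>
    using that contract[OF that] f1 by (intro norm_diff_le_of_mob_le) auto
  have cont: "isCont f \<zeta>" if "norm \<zeta> < 1" for \<zeta>
  proof -
    have "\<forall>\<^sub>F \<xi> in at \<zeta>. \<xi> \<in> ball 0 1" using that by (intro eventually_at_in_open') auto
    then have "\<forall>\<^sub>F \<xi> in at \<zeta>. norm (f \<xi> - f \<zeta>) \<le> 2 / (1 - norm \<zeta>) * norm (\<xi> - \<zeta>)"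
      by eventually_elim (use lip[OF that] in simp)
    moreover have "((\<lambda>\<xi>. 2 / (1 - norm \<zeta>) * norm (\<xi> - \<zeta>)) \<longlongrightarrow> 2 / (1 - norm \<zeta>) * norm (\<zeta> - \<zeta>)) (at \<zeta>)"
      by (intro tendsto_intros) (use that in auto)
    then have "((\<lambda>\<xi>. 2 / (1 - norm \<zeta>) * norm (\<xi> - \<zeta>)) \<longlongrightarrow> 0) (at \<zeta>)" by simp
    ultimately have "((\<lambda>\<xi>. f \<xi> - f \<zeta>) \<longlongrightarrow> 0) (at \<zeta>)" by (rule Lim_null_comparison)
    then show ?thesis unfolding isCont_def using LIM_zero_iff by blast
  qed
  have "f field_differentiable at \<zeta>" if \<zeta>: "norm \<zeta> < 1" for \<zeta>
  proof (rule ccontr)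
    assume nd: "\<not> f field_differentiable at \<zeta>"
    define \<rho> where "\<rho> = 1 - norm \<zeta>"
    have \<rho>: "\<rho> > 0" using \<zeta> by (simp add: \<rho>_def)
    have in1: "norm (\<zeta> + h) < 1" if "h \<in> ball 0 \<rho> - {0}" for h
      using that norm_triangle_ineq[of \<zeta> h] by (simp add: \<rho>_def)
    \<comment> \<open>Every cluster value of this quotient at 0 is a limit slope of \<open>V\<close>
      at the graph point over \<zeta>.\<close>
    define q where "q h = (f (\<zeta> + h) - f \<zeta>) / h" for h
    have qc: "continuous_on (ball 0 \<rho> - {0}) q"
    proof -
      have "continuous_on (ball 0 1) f" using cont by (intro continuous_at_imp_continuous_on) simp
      moreover have "continuous_on (ball 0 \<rho> - {0}) (\<lambda>h. \<zeta> + h)" by (intro continuous_intros)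
      moreover have "(\<lambda>h. \<zeta> + h) ` (ball 0 \<rho> - {0}) \<subseteq> ball 0 1"
        using in1 by (metis image_subsetI mem_ball_0)
      ultimately have "continuous_on (ball 0 \<rho> - {0}) (\<lambda>h. f (\<zeta> + h))"
        by (rule continuous_on_compose2)
      then show ?thesis unfolding q_def by (intro continuous_intros) auto
    qed
    have qb: "norm (q h) \<le> 2 / (1 - norm \<zeta>)" if h: "h \<in> ball 0 \<rho> - {0}" for h
      using lip[OF \<zeta> in1[OF h]] h by (simp add: q_def norm_divide divide_le_eq)
    have qn: "\<not> (q \<longlongrightarrow> l) (at 0)" for l
      using nd unfolding q_def field_differentiable_def DERIV_def by blast
    obtain S where S: "infinite S" "bounded S"
      "\<And>s e. s \<in> S \<Longrightarrow> e > 0 \<Longrightarrow> \<exists>h. h \<in> ball 0 \<rho> - {0} \<and> norm h < e \<and> norm (q h - s) < e"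
      using bounded_not_convergent_infinite_cluster[OF qc \<rho> qb qn] by metis
    define x where "x = pt i \<zeta> (f \<zeta>)"
    have xV: "x \<in> V" unfolding x_def by (rule fV[OF \<zeta>])
    have "x \<in> interior V"
    proof (rule infinitely_many_tangent_slopes_interior[OF V xV ik S(1,2)])
      fix s and e :: real assume "s \<in> S" "e > 0"
      then obtain h where h: "h \<in> ball 0 \<rho> - {0}" "norm h < e" "norm (q h - s) < e" using S(3) by blast
      have "pt i (\<zeta> + h) (f (\<zeta> + h)) = x + h *s pt i 1 (q h)"
        using h(1) ik by (intro pt_eqI[OF ik]) (auto simp: x_def q_def)
      then have "x + h *s pt i 1 (q h) \<in> V" using fV[OF in1[OF h(1)]] by simp
      then show "\<exists>h s'. 0 < norm h \<and> norm h < e \<and> norm (s' - s) < e \<and> x + h *s pt i 1 s' \<in> V"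
        using h by (intro exI[of _ h] exI[of _ "q h"]) simp
    qed
    then obtain \<epsilon> where \<epsilon>: "\<epsilon> > 0" "ball x \<epsilon> \<subseteq> V" by (auto simp: mem_interior)
    \<comment> \<open>An interior point of \<open>V\<close> allows moving coordinate
      \<open>k\<close> alone, against injectivity of the projection.\<close>
    define y where "y = x + pt i 0 (of_real (\<epsilon> / 2))"
    have "norm (pt i 0 (of_real (\<epsilon> / 2))) \<le> \<epsilon> / 2"
      using norm_pt_le[of i 0 "of_real (\<epsilon> / 2)"] \<epsilon>(1) by simp
    then have "y \<in> ball x \<epsilon>" using \<epsilon>(1) by (simp add: y_def dist_norm)
    then have "y \<in> V" using \<epsilon>(2) by blast
    moreover have "y $ i = x $ i" by (simp add: y_def)
    ultimately have "y = x" using inj xV by blast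
    then have "(pt i 0 (of_real (\<epsilon> / 2)) :: complex ^ 2) $ k = 0" by (simp add: y_def)
    then show False using ik \<epsilon>(1) by simp
  qed
  then show ?thesis using graph_holomorphic_retract[OF ik, of f V] f1 Vf by blast
qed

theorem corollary10:
  fixes V :: "(complex ^ 2) set"
  assumes "V \<noteq> {}"
    and "analytic_subvariety polydisc V"
    and "polynomially_convex_in polydisc V"
  shows "caratheodory_set polydisc V \<longleftrightarrow> holomorphic_retract polydisc V"
proof
  assume "holomorphic_retract polydisc V"
  with open_polydisc show "caratheodory_set polydisc V"
    by (rule holomorphic_retract_imp_caratheodory_set)
next
  assume C: "caratheodory_set polydisc V"
  have VD: "V \<subseteq> polydisc" using assms(2) by (auto simp: analytic_subvariety_def dest: closedin_imp_subset)
  have ik: "(1 :: 2) \<noteq> 2" by simp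
  show "holomorphic_retract polydisc V"
  \<comment> \<open>On a single point dominance is vacuous and the projection does not cover the
    disc; a constant map is the retraction.\<close>
  proof (cases "\<exists>v. V = {v}")
    case True
    then show ?thesis using VD singleton_holomorphic_retract by auto
  next
    case False
    then obtain v0 v1 where two: "v0 \<in> V" "v1 \<in> V" "v0 \<noteq> v1" using assms(1) by blast
    show ?thesis
    proof (cases "\<exists>z\<in>V. \<exists>w\<in>V. z \<noteq> w \<and> norm (mob (z $ 1) (w $ 1)) = norm (mob (z $ 2) (w $ 2))")
      case True
      then show ?thesis using balanced_pair_holomorphic_retract[OF assms(2,3) C ik] by blast
    next
      case False
      then consider "\<forall>z\<in>V. \<forall>w\<in>V. z \<noteq> w \<longrightarrow> norm (mob (z $ 2) (w $ 2)) < norm (mob (z $ 1) (w $ 1))"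
        | "\<forall>z\<in>V. \<forall>w\<in>V. z \<noteq> w \<longrightarrow> norm (mob (z $ 1) (w $ 1)) < norm (mob (z $ 2) (w $ 2))"
        using no_balanced_pair_dichotomy[OF caratheodory_set_connected[OF C VD] VD, of 1 2] by blast
      then show ?thesis
      proof cases
        case 1
        then show ?thesis using dominant_projection_holomorphic_retract[OF assms(2) C ik _ two] by blast
      next
        case 2
        then show ?thesis
          using dominant_projection_holomorphic_retract[OF assms(2) C ik[symmetric] _ two] by blast
      qed
    qed
  qed
qed

end
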